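(* Let $d\ge 1$, let $\Omega\subset\mathbb{R}^d$ be a bounded domain (nonempty connected open set), let $\varepsilon>0$, and let $\phi$ be either the MultiQuadric $\phi(r)=\sqrt{1+(\varepsilon r)^2}$ or the Inverse MultiQuadric $\phi(r)=1/\sqrt{1+(\varepsilon r)^2}$. Let $m\ge 1$ and let $Q_1,\dots,Q_m$ be any fixed set of $m$ distinct points of $\partial\Omega$. Let $P_1,P_2,\dots$ be a sequence of independent and identically distributed random points in $\Omega$ with respect to a probability density $\sigma\in L^1_+(\Omega)$. For $n\ge 0$, define $\phi_j(P)=\phi(\|P-P_j\|_2)$ for $1\le j\le n$ and $\psi_k(P)=\phi(\|P-Q_k\|_2)$ for $1\le k\le m$, and let $K_n$ be the $(n+m)\times(n+m)$ Kansa collocation matrix $$K_n=\begin{pmatrix}\Delta\Phi & \Delta\Psi\\ \Phi & \Psi\end{pmatrix},$$ where $\Delta\Phi=(\Delta\phi_j(P_i))_{1\le i,j\le n}$, $\Delta\Psi=(\Delta\psi_k(P_i))_{1\le i\le n,\,1\le k\le m}$, $\Phi=(\phi_j(Q_h))_{1\le h\le m,\,1\le j\le n}$, $\Psi=(\psi_k(Q_h))_{1\le h,k\le m}$, and $\Delta=\sum_{l=1}^d\partial^2/\partial x_l^2$ is the Laplacian. Then for every $m\ge1$ and every $n\ge 0$ the matrix $K_n$ is almost surely nonsingular.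
   Context: This is the matrix of unsymmetric Kansa collocation for the Dirichlet problem of the Poisson equation $\Delta u=f$ in $\Omega$, $u=g$ on $\partial\Omega$: one seeks $u_N=\sum_{j=1}^n c_j\phi_j+\sum_{k=1}^m d_k\psi_k$ with $\Delta u_N(P_i)=f(P_i)$, $i=1,\dots,n$, and $u_N(Q_h)=g(Q_h)$, $h=1,\dots,m$. For $n=0$ the matrix $K_0$ is just $\Psi$. "Almost surely" refers to the joint distribution of the i.i.d. random points $P_1,\dots,P_n$ with density $\sigma$ (a nonnegative integrable function on $\Omega$ with integral 1). *)

theory Defs
  imports "HOL-Probability.Probability" "Jordan_Normal_Form.Determinant"
begin

definition MQ :: "real \<Rightarrow> real \<Rightarrow> real" where
  "MQ eps r = sqrt (1 + (eps * r)^2)"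

definition IMQ :: "real \<Rightarrow> real \<Rightarrow> real" where
  "IMQ eps r = 1 / sqrt (1 + (eps * r)^2)"

definition second_partial :: "('a::euclidean_space \<Rightarrow> real) \<Rightarrow> 'a \<Rightarrow> 'a \<Rightarrow> real" where
  "second_partial f b x = deriv (deriv (\<lambda>t. f (x + t *\<^sub>R b))) 0"

definition laplacian :: "('a::euclidean_space \<Rightarrow> real) \<Rightarrow> 'a \<Rightarrow> real" where
  "laplacian f x = (\<Sum>b\<in>Basis. second_partial f b x)"

definition kansa_matrix ::
  "(real \<Rightarrow> real) \<Rightarrow> (nat \<Rightarrow> 'a::euclidean_space) \<Rightarrow> nat \<Rightarrow> (nat \<Rightarrow> 'a) \<Rightarrow> nat \<Rightarrow> real mat" where
  "kansa_matrix phi Q m P n =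
     mat (n + m) (n + m) (\<lambda>(i, j).
       let c = (if j < n then P j else Q (j - n));
           f = (\<lambda>x. phi (norm (x - c)))
       in if i < n then laplacian f (P i) else f (Q (i - n)))"

end

theory Submission
  imports Defs "HOL-Complex_Analysis.Complex_Analysis" "HOL-Real_Asymp.Real_Asymp"
begin

text \<open>
  Write \<open>w = sqrt (1 + (\<epsilon> r)\<^sup>2)\<close>. Both radial functions and their Laplacians are odd rational functions
  of \<open>w\<close>, and the Laplacians have a pole at \<open>w = 0\<close>. The case without interior points is
  Micchelli's theorem. For the rest, add interior points one at a time. As a function of the new
  point \<open>P\<close> the determinant is real analytic in each coordinate, so its zero set is null unless it
  vanishes identically. Suppose it does. Restrict \<open>P\<close> to a real line through a boundary point \<open>Q\<close>
  and continue analytically to the complex point of that line where \<open>w(P - Q) = 0\<close>. All other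
  square roots are regular there, and going around this branch point changes the sign of
  \<open>w(P - Q)\<close> only. In the even part of the determinant the most singular term is the product of the
  two entries coupling \<open>P\<close> and \<open>Q\<close>, and its coefficient is, up to sign, the determinant of the
  problem with both \<open>P\<close> and \<open>Q\<close> removed; this must vanish, contradicting the induction hypothesis,
  which therefore ranges over all numbers of boundary points. Once no boundary point is left, sending
  \<open>P\<close> to infinity isolates the nonzero diagonal entry.
\<close>

section \<open>Determinants over finite index sets\<close>

text \<open>Indexing by an arbitrary set lets the induction delete two points without renumbering
  the others.\<close>

definition leibniz_det :: "nat set \<Rightarrow> (nat \<Rightarrow> nat \<Rightarrow> 'b) \<Rightarrow> 'b::comm_ring_1" where
  "leibniz_det I A = (\<Sum>p | p permutes I. of_int (sign p) * (\<Prod>i\<in>I. A i (p i)))"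

lemma leibniz_det_cong:
  assumes "\<And>i j. i \<in> I \<Longrightarrow> j \<in> I \<Longrightarrow> A i j = B i j"
  shows "leibniz_det I A = leibniz_det I B"
  unfolding leibniz_det_def
  by (intro sum.cong refl arg_cong2[where f="(*)"] prod.cong) (auto simp: assms permutes_in_image)

lemma leibniz_det_of_real:
  "leibniz_det I (\<lambda>i j. complex_of_real (A i j)) = of_real (leibniz_det I A)"
  unfolding leibniz_det_def by simp

lemma det_eq_leibniz_det: "det (mat n n f) = leibniz_det {0..<n} (\<lambda>i j. f (i, j))"
  unfolding leibniz_det_def det_def
  by (auto intro!: sum.cong prod.cong simp: permutes_in_image)

text \<open>Conjugation by \<open>f\<close> permutes the summation range and preserves signs. This
  allows the points to be renumbered.\<close>

lemma leibniz_det_reindex: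
  assumes I: "finite I" and f: "f permutes I"
  shows "leibniz_det I (\<lambda>i j. A (f i) (f j)) = leibniz_det I A"
proof -
  have fp: "permutation f" using assms permutation_permutes by blast
  have "leibniz_det I A = (\<Sum>p | p permutes I. of_int (sign (f \<circ> p \<circ> Hilbert_Choice.inv f)) * (\<Prod>i\<in>I. A i ((f \<circ> p \<circ> Hilbert_Choice.inv f) i)))"
    unfolding leibniz_det_def
  proof (rule sum.reindex_bij_witness[where i="\<lambda>p. f \<circ> p \<circ> Hilbert_Choice.inv f" and j="\<lambda>p. Hilbert_Choice.inv f \<circ> p \<circ> f"])
    show "f \<circ> (Hilbert_Choice.inv f \<circ> a \<circ> f) \<circ> Hilbert_Choice.inv f = a" if "a \<in> {p. p permutes I}" for a
      using f by (simp add: fun_eq_iff permutes_inverses)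
    show "Hilbert_Choice.inv f \<circ> (f \<circ> a \<circ> Hilbert_Choice.inv f) \<circ> f = a" if "a \<in> {p. p permutes I}" for a
      using f by (simp add: fun_eq_iff permutes_inverses)
    show "Hilbert_Choice.inv f \<circ> a \<circ> f \<in> {p. p permutes I}" if "a \<in> {p. p permutes I}" for a
      using that f permutes_compose[OF f permutes_compose[OF _ permutes_inv[OF f]]] by (simp add: comp_assoc)
    show "f \<circ> a \<circ> Hilbert_Choice.inv f \<in> {p. p permutes I}" if "a \<in> {p. p permutes I}" for a
      using that f permutes_compose[OF permutes_inv[OF f] permutes_compose[OF _ f]] by (simp add: comp_assoc)
    show "of_int (sign (f \<circ> (Hilbert_Choice.inv f \<circ> p \<circ> f) \<circ> Hilbert_Choice.inv f)) *
        (\<Prod>i\<in>I. A i ((f \<circ> (Hilbert_Choice.inv f \<circ> p \<circ> f) \<circ> Hilbert_Choice.inv f) i))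
      = of_int (sign p) * (\<Prod>i\<in>I. A i (p i))" for p
    proof -
      have "f \<circ> (Hilbert_Choice.inv f \<circ> p \<circ> f) \<circ> Hilbert_Choice.inv f = p"
        using f by (simp add: fun_eq_iff permutes_inverses)
      then show ?thesis by simp
    qed
  qed
  also have "\<dots> = (\<Sum>p | p permutes I. of_int (sign p) * (\<Prod>i\<in>I. A (f i) (f (p i))))"
  proof (rule sum.cong[OF refl], goal_cases)
    case (1 p)
    then have p: "p permutes I" by simp
    have pp: "permutation p" using I p permutation_permutes by blast
    have "sign (f \<circ> p \<circ> Hilbert_Choice.inv f) = sign p"
      using fp pp by (simp add: sign_compose permutation_compose permutation_inverse sign_inverse mult.commute)
    moreover have "(\<Prod>i\<in>I. A i ((f \<circ> p \<circ> Hilbert_Choice.inv f) i)) = (\<Prod>i\<in>I. A (f i) ((f \<circ> p \<circ> Hilbert_Choice.inv f) (f i)))"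
      by (subst prod.permute[OF f]) (simp add: o_def)
    ultimately show ?case using f by (simp add: permutes_inverses)
  qed
  finally show ?thesis unfolding leibniz_det_def by simp
qed

text \<open>Permutations of \<open>I\<close> fixing \<open>a\<close> are exactly the permutations of
  \<open>I - {a}\<close>. The sum is the cofactor of the diagonal entry at \<open>a\<close>.\<close>

lemma leibniz_det_fixing:
  assumes I: "finite I" and a: "a \<in> I"
  shows "(\<Sum>p | p permutes I \<and> p a = a. of_int (sign p) * (\<Prod>i\<in>I - {a}. A i (p i))) = leibniz_det (I - {a}) A"
proof -
  have "{p. p permutes I \<and> p a = a} = {p. p permutes I - {a}}"
    using a permutes_superset[of _ I "I - {a}"] permutes_subset[of _ "I - {a}" I]
    by (auto simp: permutes_not_in)
  then show ?thesis unfolding leibniz_det_def by simp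
qed

text \<open>Composition with the transposition of \<open>a\<close> and \<open>b\<close> is a
  bijection onto the permutations of \<open>I - {a, b}\<close> and flips the sign. The sum is the
  coefficient of the product of the two entries coupling \<open>a\<close> and
  \<open>b\<close>.\<close>

lemma leibniz_det_swapping:
  assumes I: "finite I" and ab: "a \<in> I" "b \<in> I" "a \<noteq> b"
  shows "(\<Sum>p | p permutes I \<and> p a = b \<and> p b = a. of_int (sign p) * (\<Prod>i\<in>I - {a, b}. A i (p i)))
       = - leibniz_det (I - {a, b}) A"
proof -
  let ?t = "Transposition.transpose a b"
  have "(\<Sum>p | p permutes I \<and> p a = b \<and> p b = a. of_int (sign p) * (\<Prod>i\<in>I - {a, b}. A i (p i)))
      = (\<Sum>p | p permutes I - {a, b}. - (of_int (sign p) * (\<Prod>i\<in>I - {a, b}. A i (p i))))"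
  proof (rule sum.reindex_bij_witness[where i="\<lambda>p. p \<circ> ?t" and j="\<lambda>p. p \<circ> ?t"])
    fix p assume "p \<in> {p. p permutes I \<and> p a = b \<and> p b = a}"
    then have p: "p permutes I" "p a = b" "p b = a" by auto
    have tp: "?t permutes I" using ab by (simp add: permutes_swap_id)
    show "p \<circ> ?t \<circ> ?t = p" by (simp add: comp_assoc)
    have "p \<circ> ?t permutes I" using p tp permutes_compose by blast
    then have "p \<circ> ?t permutes I - {a, b}"
      by (rule permutes_superset) (use p in auto)
    then show "p \<circ> ?t \<in> {p. p permutes I - {a, b}}" by simp
    have pp: "permutation p" using I p permutation_permutes by blast
    have "sign (p \<circ> ?t) = - sign p" using ab pp
      by (simp add: sign_compose permutation_swap_id sign_swap_id)
    moreover have "(\<Prod>i\<in>I - {a, b}. A i ((p \<circ> ?t) i)) = (\<Prod>i\<in>I - {a, b}. A i (p i))"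
      by (rule prod.cong) (auto simp: transpose_def)
    ultimately show "- (of_int (sign (p \<circ> ?t)) * (\<Prod>i\<in>I - {a, b}. A i ((p \<circ> ?t) i)))
       = of_int (sign p) * (\<Prod>i\<in>I - {a, b}. A i (p i))" by simp
  next
    fix p assume "p \<in> {p. p permutes I - {a, b}}"
    then have p: "p permutes I - {a, b}" by simp
    have tp: "?t permutes I" using ab by (simp add: permutes_swap_id)
    show "p \<circ> ?t \<circ> ?t = p" by (simp add: comp_assoc)
    have "p \<circ> ?t permutes I" using p tp permutes_compose permutes_subset by blast
    moreover have "p a = a" "p b = b" using p by (auto simp: permutes_not_in)
    ultimately show "p \<circ> ?t \<in> {p. p permutes I \<and> p a = b \<and> p b = a}" by auto
  qed
  then show ?thesis by (simp add: leibniz_det_def sum_negf)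
qed

section \<open>Null sets by Fubini\<close>

text \<open>Fubini for the indicator of the exceptional set: almost every section of it is
  null.\<close>

lemma (in product_sigma_finite) AE_PiM_insert:
  assumes I: "finite I" "i \<notin> I"
    and m: "Measurable.pred (Pi\<^sub>M (insert i I) M) R"
    and AE: "AE x in Pi\<^sub>M I M. AE y in M i. R (x(i := y))"
  shows "AE x in Pi\<^sub>M (insert i I) M. R x"
proof -
  let ?f = "\<lambda>x. indicator {x \<in> space (Pi\<^sub>M (insert i I) M). \<not> R x} x :: ennreal"
  have f[measurable]: "?f \<in> borel_measurable (Pi\<^sub>M (insert i I) M)" using m by measurable
  have "(\<integral>\<^sup>+ x. ?f x \<partial>Pi\<^sub>M (insert i I) M) = (\<integral>\<^sup>+ x. (\<integral>\<^sup>+ y. ?f (x(i := y)) \<partial>(M i)) \<partial>Pi\<^sub>M I M)"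
    by (rule product_nn_integral_insert[OF I f])
  also have "\<dots> = (\<integral>\<^sup>+ x. 0 \<partial>Pi\<^sub>M I M)"
  proof (rule nn_integral_cong_AE)
    show "AE x in Pi\<^sub>M I M. (\<integral>\<^sup>+ y. ?f (x(i := y)) \<partial>(M i)) = 0"
      using AE
    proof (eventually_elim)
      case (elim x)
      have "(\<integral>\<^sup>+ y. ?f (x(i := y)) \<partial>(M i)) = (\<integral>\<^sup>+ y. 0 \<partial>(M i))"
        by (rule nn_integral_cong_AE) (use elim in \<open>auto split: split_indicator\<close>)
      then show ?case by simp
    qed
  qed
  finally have "(\<integral>\<^sup>+ x. ?f x \<partial>Pi\<^sub>M (insert i I) M) = 0" by simp
  then have "AE x in Pi\<^sub>M (insert i I) M. ?f x = 0"
    by (subst (asm) nn_integral_0_iff_AE) (use f in auto)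
  then show ?thesis by (rule AE_mp) (auto intro!: AE_I2 split: split_indicator_asm)
qed

text \<open>Coordinates are freed one at a time, starting from \<open>x0\<close>: a nonzero value
  survives almost surely when the next coordinate varies. Only one-variable information on
  coordinate lines is thus required.\<close>

lemma AE_lborel_coordinatewise:
  fixes f :: "'a::euclidean_space \<Rightarrow> 'b::{real_normed_vector, second_countable_topology}"
  assumes f[measurable]: "f \<in> borel_measurable borel"
    and line: "\<And>x b. b \<in> Basis \<Longrightarrow> f x \<noteq> 0 \<Longrightarrow> AE t in lborel. f (x + t *\<^sub>R b) \<noteq> 0"
    and x0: "f x0 \<noteq> 0"
  shows "AE x in lborel. f x \<noteq> 0"
proof -
  interpret product_sigma_finite "\<lambda>_::'a. lborel :: real measure"
    by unfold_locales
  have *: "AE y in Pi\<^sub>M J (\<lambda>_. lborel). f (x0 + (\<Sum>b\<in>J. y b *\<^sub>R b)) \<noteq> 0" if "finite J" "J \<subseteq> Basis" for J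
    using that
  proof (induction J)
    case empty
    show ?case using x0 by simp
  next
    case (insert c J)
    have cb: "c \<in> Basis" using insert by auto
    show ?case
    proof (rule AE_PiM_insert)
      show "Measurable.pred (Pi\<^sub>M (insert c J) (\<lambda>_. lborel)) (\<lambda>y. f (x0 + (\<Sum>b\<in>insert c J. y b *\<^sub>R b)) \<noteq> 0)"
        by measurable
      have "AE y in Pi\<^sub>M J (\<lambda>_. lborel). f (x0 + (\<Sum>b\<in>J. y b *\<^sub>R b)) \<noteq> 0"
        using insert by auto
      then show "AE x in Pi\<^sub>M J (\<lambda>_. lborel). AE y in lborel. f (x0 + (\<Sum>b\<in>insert c J. (x(c := y)) b *\<^sub>R b)) \<noteq> 0"
      proof eventually_elim
        case (elim x)
        have "(\<Sum>b\<in>J. (x(c := y)) b *\<^sub>R b) = (\<Sum>b\<in>J. x b *\<^sub>R b)" for y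
          using insert by (intro sum.cong) auto
        then show ?case using line[OF cb elim] insert by (simp add: add_ac)
      qed
    qed (use insert in auto)
  qed
  \<comment> \<open>\<open>lborel\<close> is the image of the product of one-dimensional Lebesgue
    measures under the coordinate sum; translation invariance then removes
    \<open>x0\<close>.\<close>
  have "AE x in lborel. f (x0 + x) \<noteq> 0"
    unfolding lborel_def[where 'a='a] lborel_eq_real[symmetric]
    by (subst AE_distr_iff) (use *[of Basis] in auto)
  then have "AE x in distr lborel borel ((+) x0). f x \<noteq> 0"
    by (subst AE_distr_iff) auto
  then show ?thesis by (simp only: lborel_distr_plus)
qed

text \<open>By the identity theorem, a nonconstant \<open>F\<close> has finitely many zeros on each
  compact segment of the real axis.\<close>

lemma countable_real_zeros:
  assumes "F holomorphic_on T" "open T" "connected T" and T: "\<And>t::real. of_real t \<in> T"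
    and nz: "F (of_real s) \<noteq> 0"
  shows "countable {t::real. F (of_real t) = 0}"
proof (cases "F constant_on T")
  case True
  then have "F (of_real t) \<noteq> 0" for t
    using nz T unfolding constant_on_def by metis
  then show ?thesis by simp
next
  case False
  have "finite {t\<in>{-real n..real n}. F (of_real t) = 0}" for n
  proof -
    have "finite {z \<in> complex_of_real ` {-real n..real n}. F z = 0}"
      by (rule holomorphic_compact_finite_zeros[OF assms(1-3) _ _ False])
         (use T in \<open>auto intro!: compact_continuous_image continuous_intros\<close>)
    moreover have "complex_of_real ` {t\<in>{-real n..real n}. F (of_real t) = 0} \<subseteq> {z \<in> complex_of_real ` {-real n..real n}. F z = 0}"
      by auto
    ultimately show ?thesis
      using finite_subset finite_imageD inj_of_real by (metis (no_types, lifting) inj_on_subset subset_UNIV)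
  qed
  moreover have "{t. F (of_real t) = 0} = (\<Union>n. {t\<in>{-real n..real n}. F (of_real t) = 0})"
  proof -
    have "\<exists>n. t \<in> {-real n..real n}" for t
    proof -
      obtain n where "\<bar>t\<bar> \<le> real n" using real_arch_simple by blast
      then have "t \<in> {-real n..real n}" by auto
      then show ?thesis ..
    qed
    then show ?thesis by auto
  qed
  ultimately show ?thesis by (simp add: countable_finite)
qed

section \<open>Kernels that are odd functions of the multiquadric weight\<close>

definition mq_weight :: "real \<Rightarrow> 'a::euclidean_space \<Rightarrow> real" where
  "mq_weight eps z = sqrt (1 + (eps * norm z)^2)"

lemma mq_weight_ge1: "mq_weight eps z \<ge> 1" and mq_weight_pos: "mq_weight eps z > 0"
proof -
  show "mq_weight eps z \<ge> 1" by (simp add: mq_weight_def)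
  then show "mq_weight eps z > 0" by linarith
qed

lemma mq_weight_0 [simp]: "mq_weight eps 0 = 1"
  by (simp add: mq_weight_def)

lemma mq_weight_minus_commute: "mq_weight eps (x - y) = mq_weight eps (y - x)"
  by (simp add: mq_weight_def norm_minus_commute)

lemma norm_add_scaleR_power2:
  "(norm (x + t *\<^sub>R b))\<^sup>2 = (norm x)\<^sup>2 + 2 * t * (x \<bullet> b) + t\<^sup>2 * (norm b)\<^sup>2"
  unfolding power2_norm_eq_inner by (simp add: inner_add_left inner_add_right inner_commute power2_eq_square algebra_simps)

text \<open>\<open>kc\<close> and \<open>lc\<close> are the radial function and its Laplacian, as functions of the weight.\<close>

locale kansa_kernel =
  fixes eps :: real and kc lc :: "complex \<Rightarrow> complex"
  assumes eps: "eps > 0"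
    and kc_holomorphic: "kc holomorphic_on -{0}" and lc_holomorphic: "lc holomorphic_on -{0}"
    and kc_odd: "kc (-w) = - kc w" and lc_odd: "lc (-w) = - lc w"
    and pole: "\<exists>k c. k > 0 \<and> c \<noteq> 0 \<and> ((\<lambda>w. w^k * (lc w * kc w)) \<longlongrightarrow> c) (at 0)"
    and lc_at_infinity: "(lc \<longlongrightarrow> 0) at_infinity"
    and lc_1: "lc 1 \<noteq> 0"
begin

text \<open>\<open>S\<close> is the set of interior indices: their rows carry the differential
  equation, all other rows the boundary condition. Columns need no such distinction, since all trial
  functions are translates of one radial function.\<close>

definition kernel :: "nat set \<Rightarrow> nat \<Rightarrow> complex \<Rightarrow> complex" where
  "kernel S i = (if i \<in> S then lc else kc)"

definition entry :: "nat set \<Rightarrow> (nat \<Rightarrow> 'a::euclidean_space) \<Rightarrow> nat \<Rightarrow> nat \<Rightarrow> complex" where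
  "entry S X i j = kernel S i (of_real (mq_weight eps (X i - X j)))"

lemma kernel_holomorphic: "kernel S i holomorphic_on -{0}"
  by (simp add: kernel_def kc_holomorphic lc_holomorphic)

lemma kernel_holomorphic':
  "f holomorphic_on A \<Longrightarrow> (\<And>z. z \<in> A \<Longrightarrow> f z \<noteq> 0) \<Longrightarrow> (\<lambda>z. kernel S i (f z)) holomorphic_on A"
  using holomorphic_on_compose_gen[OF _ kernel_holomorphic, of f A S i] by (force simp: o_def)

lemma kernel_continuous: "w \<noteq> 0 \<Longrightarrow> isCont (kernel S i) w"
  using holomorphic_on_imp_continuous_on[OF kernel_holomorphic]
  by (metis ComplI continuous_on_eq_continuous_at open_Compl closed_singleton singletonD)

lemma entry_measurable:
  fixes X :: "'w \<Rightarrow> nat \<Rightarrow> 'a::euclidean_space"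
  assumes [measurable]: "\<And>i. (\<lambda>\<omega>. X \<omega> i) \<in> borel_measurable N"
  shows "(\<lambda>\<omega>. entry S (X \<omega>) i j) \<in> borel_measurable N"
proof -
  have "continuous_on UNIV (\<lambda>z::'a. kernel S i (of_real (mq_weight eps z)))"
  proof -
    have "isCont (\<lambda>z::'a. kernel S i (of_real (mq_weight eps z))) z" for z
    proof (rule isCont_o2[where g="kernel S i"])
      show "isCont (\<lambda>z. complex_of_real (mq_weight eps z)) z"
        unfolding mq_weight_def by (intro continuous_intros)
      show "isCont (kernel S i) (complex_of_real (mq_weight eps z))"
        using mq_weight_pos[of eps z] by (intro kernel_continuous) auto
    qed
    then show ?thesis by (simp add: continuous_on_eq_continuous_at)
  qed
  then have [measurable]: "(\<lambda>z::'a. kernel S i (of_real (mq_weight eps z))) \<in> borel_measurable borel"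
    by (rule borel_measurable_continuous_onI)
  show ?thesis unfolding entry_def by measurable
qed

lemma leibniz_det_measurable:
  assumes "\<And>i. (\<lambda>\<omega>. X \<omega> i) \<in> borel_measurable N"
  shows "(\<lambda>\<omega>. leibniz_det I (entry S (X \<omega>))) \<in> borel_measurable N"
  unfolding leibniz_det_def using entry_measurable[OF assms] by measurable

section \<open>Analytic dependence on one point\<close>

text \<open>Along a coordinate line the determinant extends holomorphically to a strip around the
  real axis. It is nonzero at \<open>t = 0\<close>, so its real zeros are countable.\<close>

lemma AE_line:
  fixes x b :: "'a::euclidean_space" and X :: "nat \<Rightarrow> 'a"
  assumes b: "b \<in> Basis" and nz: "leibniz_det I (entry S (X(a := x))) \<noteq> 0"
  shows "AE t in lborel. leibniz_det I (entry S (X(a := x + t *\<^sub>R b))) \<noteq> 0"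
proof -
  \<comment> \<open>The squared weight of \<open>x + t b - X j\<close>, a polynomial in
    \<open>t\<close>, extended to complex \<open>t\<close>.\<close>
  define q where "q j z = 1 + (of_real eps)\<^sup>2 * (of_real ((norm (x - X j))\<^sup>2) + 2 * z * of_real ((x - X j) \<bullet> b) + z\<^sup>2)" for j :: nat and z :: complex
  define F where "F z = leibniz_det I (\<lambda>i j. kernel S i
     (if i = a \<and> j = a then 1 else if i = a then csqrt (q j z) else if j = a then csqrt (q i z)
      else of_real (mq_weight eps (X i - X j))))" for z
  \<comment> \<open>on this strip every \<open>q j\<close> has positive real part, so the principal square root is holomorphic\<close>
  define T where "T = {z::complex. \<bar>Im z\<bar> < 1 / eps}"
  have T: "open T" "connected T" "of_real t \<in> T" for t
  proof -
    have T': "T = {z. Im z < 1 / eps} \<inter> {z. Im z > - (1 / eps)}" by (auto simp: T_def)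
    show "open T" unfolding T' by (intro open_Int open_halfspace_Im_lt open_halfspace_Im_gt)
    have "convex T" unfolding T' by (intro convex_Int convex_halfspace_Im_lt convex_halfspace_Im_gt)
    then show "connected T" by (rule convex_connected)
    show "of_real t \<in> T" using eps by (simp add: T_def)
  qed
  have Re_q: "Re (q j z) > 0" if z: "z \<in> T" for j z
  proof -
    \<comment> \<open>This discriminant bound makes the quadratic in \<open>Re z\<close>
      nonnegative, so only \<open>(eps * Im z)^2 < 1\<close> is subtracted from 1 in
      \<open>Re (q j z)\<close>.\<close>
    have "((x - X j) \<bullet> b)\<^sup>2 \<le> (norm (x - X j))\<^sup>2"
      using Basis_le_norm[OF b, of "x - X j"] by (metis abs_ge_zero power2_abs power_mono)
    then have "(norm (x - X j))\<^sup>2 + 2 * Re z * ((x - X j) \<bullet> b) + (Re z)\<^sup>2 \<ge> 0"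
      using zero_le_power2[of "(x - X j) \<bullet> b + Re z"] by (simp add: power2_eq_square algebra_simps)
    then have "eps\<^sup>2 * ((norm (x - X j))\<^sup>2 + 2 * Re z * ((x - X j) \<bullet> b) + (Re z)\<^sup>2) \<ge> 0"
      by simp
    moreover have "(eps * Im z)\<^sup>2 < 1"
    proof -
      have "\<bar>eps * Im z\<bar> < 1" using z eps by (simp add: T_def abs_mult field_simps)
      then show ?thesis by (simp add: abs_square_less_1)
    qed
    moreover have "Re (q j z) = 1 - (eps * Im z)\<^sup>2
        + eps\<^sup>2 * ((norm (x - X j))\<^sup>2 + 2 * Re z * ((x - X j) \<bullet> b) + (Re z)\<^sup>2)"
      by (simp add: q_def power2_eq_square algebra_simps)
    ultimately show ?thesis by linarith
  qed
  have q0: "q j z \<notin> \<real>\<^sub>\<le>\<^sub>0" "q j z \<noteq> 0" if "z \<in> T" for j z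
    using Re_q[OF that, of j] by (auto simp: complex_nonpos_Reals_iff)
  have mq0: "mq_weight eps z \<noteq> 0" for z :: 'a using mq_weight_pos[of eps z] by simp
  have qhol: "(\<lambda>z. csqrt (q j z)) holomorphic_on T" for j
    by (rule holomorphic_on_csqrt') (use q0 in \<open>auto simp: q_def intro!: holomorphic_intros\<close>)
  have "(\<lambda>z. kernel S i
     (if i = a \<and> j = a then 1 else if i = a then csqrt (q j z) else if j = a then csqrt (q i z)
      else of_real (mq_weight eps (X i - X j)))) holomorphic_on T" for i j
    by (rule kernel_holomorphic'; cases "i = a"; cases "j = a") (simp_all add: qhol q0 mq0)
  then have "F holomorphic_on T"
    unfolding F_def leibniz_det_def by (intro holomorphic_on_sum holomorphic_on_mult holomorphic_on_const holomorphic_on_prod)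
  moreover have F: "F (of_real t) = leibniz_det I (entry S (X(a := x + t *\<^sub>R b)))" for t
  proof -
    have c: "csqrt (q j (of_real t)) = of_real (mq_weight eps (x + t *\<^sub>R b - X j))" for j
    proof -
      have *: "x + t *\<^sub>R b - X j = (x - X j) + t *\<^sub>R b" by simp
      have "q j (of_real t) = of_real (1 + (eps * norm (x + t *\<^sub>R b - X j))\<^sup>2)"
        unfolding q_def * power_mult_distrib norm_add_scaleR_power2 using b by (simp add: norm_Basis)
      then show ?thesis unfolding mq_weight_def by (simp only: csqrt_of_real_nonneg) (simp add: csqrt_of_real_nonneg)
    qed
    show ?thesis unfolding F_def
      by (rule leibniz_det_cong) (auto simp: entry_def c mq_weight_minus_commute)
  qed
  ultimately have "countable {t. leibniz_det I (entry S (X(a := x + t *\<^sub>R b))) = 0}"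
    using countable_real_zeros[of F T 0] T nz F[of 0] by (simp flip: F)
  then have "{t. leibniz_det I (entry S (X(a := x + t *\<^sub>R b))) = 0} \<in> null_sets lborel"
    by (rule countable_imp_null_set_lborel)
  then show ?thesis using AE_not_in by fastforce
qed

lemma AE_point:
  fixes x0 :: "'a::euclidean_space"
  assumes "leibniz_det I (entry S (X(a := x0))) \<noteq> 0"
  shows "AE x in lborel. leibniz_det I (entry S (X(a := x))) \<noteq> 0"
proof (rule AE_lborel_coordinatewise[where ?x0.0=x0])
  show "(\<lambda>x. leibniz_det I (entry S (X(a := x)))) \<in> borel_measurable borel"
    by (rule leibniz_det_measurable) auto
qed (use AE_line assms in auto)

section \<open>Existence of a nonsingular position of the new point\<close>

text \<open>With interior points only, every entry involves \<open>lc\<close>, which vanishes at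
  infinity. Moving \<open>a\<close> away thus decouples its row and column, and the determinant
  tends to \<open>lc 1\<close> times the smaller one. A boundary row would break this, as
  \<open>kc\<close> may grow.\<close>

lemma exists_far_point:
  fixes X :: "nat \<Rightarrow> 'a::euclidean_space"
  assumes S: "finite S" "a \<notin> S" and nz: "leibniz_det S (entry S X) \<noteq> 0"
  shows "\<exists>x. leibniz_det (insert a S) (entry (insert a S) (X(a := x))) \<noteq> 0"
proof -
  obtain v :: 'a where v: "norm v = 1" using norm_Basis nonempty_Basis by blast
  define Y where "Y r = X(a := r *\<^sub>R v)" for r :: real
  let ?E = "\<lambda>r. entry (insert a S) (Y r)"
  let ?L = "entry S X"
  have far: "((\<lambda>r. lc (of_real (mq_weight eps (r *\<^sub>R v - c)))) \<longlongrightarrow> 0) at_top" for c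
  proof -
    have "filterlim (\<lambda>r. complex_of_real (mq_weight eps (r *\<^sub>R v - c))) at_infinity at_top"
    proof (subst filterlim_at_infinity_conv_norm_at_top)
      have ge: "mq_weight eps (r *\<^sub>R v - c) \<ge> eps * (r - norm c)" for r
      proof -
        have "norm (r *\<^sub>R v - c) \<ge> r - norm c"
          using norm_triangle_ineq2[of "r *\<^sub>R v" c] v by simp
        then have "eps * (r - norm c) \<le> eps * norm (r *\<^sub>R v - c)" using eps by simp
        also have "\<dots> \<le> mq_weight eps (r *\<^sub>R v - c)"
          unfolding mq_weight_def by (rule real_le_rsqrt) simp
        finally show ?thesis .
      qed
      have "filterlim (\<lambda>r. eps * (r - norm c)) at_top at_top"
        using eps by real_asymp
      then have "filterlim (\<lambda>r. mq_weight eps (r *\<^sub>R v - c)) at_top at_top"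
        by (rule filterlim_at_top_mono) (use ge in auto)
      then show "filterlim (\<lambda>r. norm (complex_of_real (mq_weight eps (r *\<^sub>R v - c)))) at_top at_top"
        by (simp add: abs_of_pos[OF mq_weight_pos])
    qed
    then show ?thesis by (rule filterlim_compose[OF lc_at_infinity])
  qed
  have "((\<lambda>r. \<Prod>i\<in>insert a S. ?E r i (p i)) \<longlongrightarrow> (if p a = a then lc 1 * (\<Prod>i\<in>S. ?L i (p i)) else 0)) at_top"
    if p: "p permutes insert a S" for p
  proof (cases "p a = a")
    case True
    have pa: "p i \<noteq> a" if "i \<in> S" for i using True p that S by (metis permutes_inj inj_eq)
    have "(\<Prod>i\<in>insert a S. ?E r i (p i)) = lc 1 * (\<Prod>i\<in>S. ?L i (p i))" for r
    proof -
      have "(\<Prod>i\<in>S. ?E r i (p i)) = (\<Prod>i\<in>S. ?L i (p i))"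
        by (rule prod.cong) (use pa S in \<open>auto simp: entry_def kernel_def Y_def\<close>)
      then show ?thesis using S True by (simp add: entry_def kernel_def)
    qed
    then show ?thesis using True by simp
  next
    case False
    \<comment> \<open>If \<open>p\<close> moves \<open>a\<close>, the factor in row \<open>a\<close>
      and the one in column \<open>a\<close> tend to 0, while the others do not depend on
      \<open>r\<close>.\<close>
    have fac: "((\<lambda>r. ?E r i (p i)) \<longlongrightarrow> (if i = a \<or> p i = a then 0 else ?L i (p i))) at_top"
      if i: "i \<in> insert a S" for i
    proof -
      have "((\<lambda>r. ?E r i (p i)) \<longlongrightarrow> 0) at_top" if "i = a \<or> p i = a"
      proof (cases "i = a")
        case True
        then show ?thesis using far[of "X (p i)"] False by (simp add: entry_def kernel_def Y_def)
      next
        case False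
        then show ?thesis using that far[of "X i"] i
          by (simp add: entry_def kernel_def Y_def mq_weight_minus_commute[of eps "X i"])
      qed
      moreover have "?E r i (p i) = ?L i (p i)" if "\<not> (i = a \<or> p i = a)" for r
        using that i by (auto simp: entry_def kernel_def Y_def)
      ultimately show ?thesis by auto
    qed
    have "((\<lambda>r. \<Prod>i\<in>insert a S. ?E r i (p i)) \<longlongrightarrow> (\<Prod>i\<in>insert a S. if i = a \<or> p i = a then 0 else ?L i (p i))) at_top"
      by (intro tendsto_prod fac)
    then show ?thesis using False S by simp
  qed
  then have "((\<lambda>r. leibniz_det (insert a S) (?E r)) \<longlongrightarrow>
     (\<Sum>p | p permutes insert a S. of_int (sign p) * (if p a = a then lc 1 * (\<Prod>i\<in>S. ?L i (p i)) else 0))) at_top"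
    unfolding leibniz_det_def by (intro tendsto_sum tendsto_mult tendsto_const) auto
  also have "(\<Sum>p | p permutes insert a S. of_int (sign p) * (if p a = a then lc 1 * (\<Prod>i\<in>S. ?L i (p i)) else 0))
     = lc 1 * (\<Sum>p | p permutes insert a S \<and> p a = a. of_int (sign p) * (\<Prod>i\<in>insert a S - {a}. ?L i (p i)))"
    using S by (subst sum_distrib_left, intro sum.mono_neutral_cong_right)
      (auto simp: finite_permutations)
  also have "\<dots> = lc 1 * leibniz_det S ?L"
    using leibniz_det_fixing[of "insert a S" a ?L] S by simp
  finally have lim: "((\<lambda>r. leibniz_det (insert a S) (?E r)) \<longlongrightarrow> lc 1 * leibniz_det S ?L) at_top" .
  show ?thesis
  proof (rule ccontr)
    assume "\<not> ?thesis"
    then have "leibniz_det (insert a S) (?E r) = 0" for r by (auto simp: Y_def)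
    then have "lc 1 * leibniz_det S ?L = 0"
      using lim by (simp add: tendsto_const_iff)
    then show False using nz lc_1 by simp
  qed
qed

text \<open>The inductive step that removes the interior point \<open>a\<close> together with the
  boundary point \<open>b\<close>. Distinctness from \<open>X b\<close> keeps the other square roots
  away from their branch points at the place where that of \<open>X b\<close> vanishes.\<close>

lemma exists_nonsingular_near_branch_point:
  fixes X :: "nat \<Rightarrow> 'a::euclidean_space"
  assumes I: "finite I" "a \<in> I" "b \<in> I" and ab: "a \<in> S" "b \<notin> S"
    and distinct: "\<And>j. j \<in> I - {a, b} \<Longrightarrow> X j \<noteq> X b"
    and nz: "leibniz_det (I - {a, b}) (entry S X) \<noteq> 0"
  shows "\<exists>x. leibniz_det I (entry S (X(a := x))) \<noteq> 0"
proof (rule ccontr)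
  assume "\<not> ?thesis"
  then have zero: "leibniz_det I (entry S (X(a := x))) = 0" for x by blast
  have "a \<noteq> b" using ab by auto
  obtain v :: 'a where v: "v \<in> Basis" using nonempty_Basis by blast
  \<comment> \<open>\<open>P = X b + t v\<close> with \<open>t = \<i> cos \<theta> / \<epsilon>\<close> uniformises \<open>sqrt (1 + (\<epsilon> t)\<^sup>2) = sin \<theta>\<close>: real \<open>t\<close> is the line
    \<open>\<theta> = \<pi>/2 + \<i> \<eta>\<close>, the branch point is \<open>\<theta> = 0\<close>, and circling it is \<open>\<theta> \<mapsto> - \<theta>\<close>\<close>
  define R where "R j = (norm (X b - X j))\<^sup>2" for j
  define \<beta> where "\<beta> j = (X b - X j) \<bullet> v" for j
  \<comment> \<open>This is \<open>1 + eps^2 |P - X j|^2\<close>, expanded about \<open>X b\<close>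
    with \<open>t = \<i> cos \<theta> / eps\<close>, where
    \<open>1 + (eps t)^2 = sin^2 \<theta>\<close>.\<close>
  define q where "q j \<theta> = (sin \<theta>)\<^sup>2 + of_real (eps\<^sup>2 * R j) + 2 * \<i> * of_real (eps * \<beta> j) * cos \<theta>" for j and \<theta> :: complex
  \<comment> \<open>The coupling of \<open>a\<close> and \<open>b\<close> is
    \<open>sin \<theta>\<close> itself and not a principal root of its square: this branch is
    holomorphic through 0 and odd.\<close>
  define W where "W i j \<theta> = (if i = a \<and> j = a then 1 else if i = a \<and> j = b \<or> i = b \<and> j = a then sin \<theta>
      else if i = a then csqrt (q j \<theta>) else if j = a then csqrt (q i \<theta>)
      else of_real (mq_weight eps (X i - X j)))" for i j and \<theta> :: complex
  define E where "E \<theta> i j = kernel S i (W i j \<theta>)" for \<theta> i j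
  define F where "F \<theta> = leibniz_det I (E \<theta>)" for \<theta>
  define J where "J = I - {a, b}"
  have "finite J" using I by (simp add: J_def)
  have R: "R j > 0" if "j \<in> J" for j
    using distinct[of j] that by (simp add: R_def J_def)
  have mq0: "mq_weight eps z \<noteq> 0" for z :: 'a using mq_weight_pos[of eps z] by simp

  define U where "U = {\<theta>. \<forall>j\<in>J. Re (q j \<theta>) > 0}"
  define line where "line = (\<lambda>\<eta>::real. of_real (pi / 2) + \<i> * of_real \<eta>) ` UNIV"
  \<comment> \<open>Zeros of the sine are removed because the kernels may have a pole at weight 0.
    They are countable, so the remaining domain stays connected.\<close>
  define Sg where "Sg = connected_component_set U (of_real (pi / 2)) - {z. sin z = 0}"

  have trig: "sin (of_real (pi / 2) + \<i> * of_real \<eta>) = complex_of_real (cosh \<eta>)"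
    "cos (of_real (pi / 2) + \<i> * of_real \<eta>) = - \<i> * complex_of_real (sinh \<eta>)" for \<eta> :: real
  proof -
    have c: "cos (complex_of_real (pi / 2)) = 0" "sin (complex_of_real (pi / 2)) = 1"
      by (simp_all only: cos_of_real sin_of_real) simp_all
    have s: "cos (\<i> * complex_of_real \<eta>) = of_real (cosh \<eta>)" "sin (\<i> * complex_of_real \<eta>) = \<i> * of_real (sinh \<eta>)"
      by (simp_all add: cos_i_times sin_i_times cosh_field_def sinh_field_def exp_of_real[symmetric] exp_minus)
    show "sin (of_real (pi / 2) + \<i> * of_real \<eta>) = complex_of_real (cosh \<eta>)"
      "cos (of_real (pi / 2) + \<i> * of_real \<eta>) = - \<i> * complex_of_real (sinh \<eta>)"
      unfolding sin_add cos_add c s by simp_all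
  qed
  have q_line: "q j (of_real (pi / 2) + \<i> * of_real \<eta>)
      = of_real (1 + (eps * norm (X b + (sinh \<eta> / eps) *\<^sub>R v - X j))\<^sup>2)" for j \<eta>
  proof -
    have *: "X b + (sinh \<eta> / eps) *\<^sub>R v - X j = (X b - X j) + (sinh \<eta> / eps) *\<^sub>R v" by simp
    have "q j (of_real (pi / 2) + \<i> * of_real \<eta>) = of_real ((cosh \<eta>)\<^sup>2 + eps\<^sup>2 * R j + 2 * eps * \<beta> j * sinh \<eta>)"
      unfolding q_def trig by (simp add: complex_eq_iff power2_eq_square)
    also have "(cosh \<eta>)\<^sup>2 + eps\<^sup>2 * R j + 2 * eps * \<beta> j * sinh \<eta> = 1 + (eps * norm (X b + (sinh \<eta> / eps) *\<^sub>R v - X j))\<^sup>2"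
      unfolding * power_mult_distrib norm_add_scaleR_power2 R_def[symmetric] \<beta>_def[symmetric]
      using eps v by (simp add: norm_Basis cosh_square_eq distrib_left power_divide) (simp add: power2_eq_square)
    finally show ?thesis .
  qed
  \<comment> \<open>On \<open>line\<close> the parameter describes the real points
    \<open>X b + (sinh \<eta> / eps) v\<close>, where the determinant vanishes by
    assumption.\<close>
  have F_line: "F \<theta> = 0" if "\<theta> \<in> line" for \<theta>
  proof -
    obtain \<eta> :: real where \<theta>: "\<theta> = of_real (pi / 2) + \<i> * of_real \<eta>" using \<open>\<theta> \<in> line\<close> unfolding line_def by blast
    define x where "x = X b + (sinh \<eta> / eps) *\<^sub>R v"
    have c: "csqrt (q j \<theta>) = of_real (mq_weight eps (x - X j))" for j
      unfolding \<theta> q_line mq_weight_def x_def by (subst csqrt_of_real_nonneg) simp_all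
    have s: "sin \<theta> = of_real (mq_weight eps (x - X b))"
    proof -
      have "mq_weight eps (x - X b) = sqrt (1 + (sinh \<eta>)\<^sup>2)"
        using v eps by (simp add: mq_weight_def x_def norm_Basis)
      also have "\<dots> = cosh \<eta>"
        by (rule real_sqrt_unique) (simp_all add: cosh_square_eq cosh_real_nonneg)
      finally show ?thesis by (simp only: \<theta> trig)
    qed
    have "F \<theta> = leibniz_det I (entry S (X(a := x)))"
      unfolding F_def
      by (rule leibniz_det_cong)
        (use \<open>a \<noteq> b\<close> in \<open>auto simp: E_def W_def entry_def c s mq_weight_minus_commute\<close>)
    then show ?thesis using zero by simp
  qed
  have line_U: "line \<subseteq> U"
  proof -
    have "1 + (eps * norm w)\<^sup>2 > 0" for w :: 'a by (simp add: add_pos_nonneg)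
    then have "Re (q j (of_real (pi / 2) + \<i> * of_real \<eta>)) > 0" for j \<eta>
      unfolding q_line Re_complex_of_real .
    then show ?thesis unfolding line_def U_def by blast
  qed
  \<comment> \<open>the points \<open>X j \<noteq> X b\<close> have no branch point on the real \<open>\<theta>\<close>-axis\<close>
  have reals_U: "of_real t \<in> U" for t
  proof -
    have "q j (of_real t) = of_real ((sin t)\<^sup>2 + eps\<^sup>2 * R j) + \<i> * of_real (2 * eps * \<beta> j * cos t)" for j
      unfolding q_def by (simp flip: sin_of_real cos_of_real)
    then have "Re (q j (of_real t)) = (sin t)\<^sup>2 + eps\<^sup>2 * R j" for j by simp
    then show ?thesis using R eps by (auto simp: U_def intro!: add_nonneg_pos)
  qed
  have q_cont: "continuous_on UNIV (q j)" for j
    unfolding q_def by (intro continuous_intros)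
  have "open U"
  proof -
    have "U = (\<Inter>j\<in>J. {\<theta>. Re (q j \<theta>) > 0})" by (auto simp: U_def)
    moreover have "open {\<theta>. Re (q j \<theta>) > 0}" for j
      by (intro open_Collect_less continuous_intros q_cont)
    ultimately show ?thesis using \<open>finite J\<close> by (auto intro!: open_INT)
  qed
  have "countable {z::complex. sin z = 0}"
  proof -
    have "{z::complex. sin z = 0} = range (\<lambda>n::int. of_real (n * pi))" by (auto simp: sin_eq_0)
    then show ?thesis by simp
  qed
  have Sg_conn: "connected Sg" unfolding Sg_def
    by (rule connected_open_diff_countable) (use \<open>countable _\<close> \<open>open U\<close> in \<open>auto intro: open_connected_component\<close>)
  have Sg_open: "open Sg" unfolding Sg_def
    by (intro open_Diff open_connected_component \<open>open U\<close> closed_Collect_eq continuous_intros)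
  have Sg_U: "Sg \<subseteq> U" unfolding Sg_def using connected_component_subset by blast
  have line_Sg: "line \<subseteq> Sg"
  proof -
    have "connected line" unfolding line_def
      by (intro connected_continuous_image continuous_intros) simp
    moreover have "of_real (pi / 2) \<in> line" unfolding line_def by (rule image_eqI[of _ _ 0]) auto
    ultimately have "line \<subseteq> connected_component_set U (of_real (pi / 2))"
      using line_U by (intro connected_component_maximal)
    moreover have "sin z \<noteq> 0" if "z \<in> line" for z
    proof -
      obtain \<eta> :: real where "z = of_real (pi / 2) + \<i> * of_real \<eta>" using \<open>z \<in> line\<close> unfolding line_def by blast
      then have "sin z = of_real (cosh \<eta>)" by (simp only: trig)
      then show ?thesis using cosh_real_pos[of \<eta>] by simp
    qed
    ultimately show ?thesis by (auto simp: Sg_def)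
  qed
  have reals_Sg: "of_real t \<in> Sg" if "sin t \<noteq> 0" for t :: real
  proof -
    have "complex_of_real (pi / 2) \<in> complex_of_real ` UNIV" by (rule imageI) simp
    moreover have "connected (complex_of_real ` UNIV)"
      by (intro connected_continuous_image continuous_intros) simp
    ultimately have "complex_of_real ` UNIV \<subseteq> connected_component_set U (of_real (pi / 2))"
      using reals_U by (intro connected_component_maximal) auto
    then show ?thesis using that by (auto simp: Sg_def sin_of_real)
  qed
  have W_nz: "W i j \<theta> \<noteq> 0" if "\<theta> \<in> U" "i \<in> I" "j \<in> I" "\<not> (i = a \<and> j = b \<or> i = b \<and> j = a)" for i j \<theta>
  proof -
    have "q l \<theta> \<noteq> 0" if "l \<in> J" for l using \<open>\<theta> \<in> U\<close> that by (auto simp: U_def)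
    then show ?thesis using that mq0 by (auto simp: W_def J_def)
  qed
  have q_hol: "(\<lambda>\<theta>. csqrt (q j \<theta>)) holomorphic_on U" if "j \<in> J" for j
  proof (rule holomorphic_on_csqrt')
    show "q j holomorphic_on U" unfolding q_def by (intro holomorphic_intros)
    show "q j z \<notin> \<real>\<^sub>\<le>\<^sub>0" if "z \<in> U" for z
      using that \<open>j \<in> J\<close> by (force simp: U_def complex_nonpos_Reals_iff)
  qed
  have W_hol: "(\<lambda>\<theta>. W i j \<theta>) holomorphic_on U" if ij: "i \<in> I" "j \<in> I" for i j
  proof -
    consider "i = a \<and> j = a" | "i = a \<and> j = b \<or> i = b \<and> j = a" | "i = a" "j \<in> J" | "j = a" "i \<in> J" | "i \<noteq> a" "j \<noteq> a"
      using ij by (auto simp: J_def)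
    then show ?thesis
    proof cases
      case 2
      then have "W i j = sin" using \<open>a \<noteq> b\<close> by (auto simp: W_def)
      then show ?thesis by (simp add: holomorphic_on_sin)
    next
      case 3
      then have "W i j = (\<lambda>\<theta>. csqrt (q j \<theta>))" using \<open>a \<noteq> b\<close> by (auto simp: W_def J_def fun_eq_iff)
      then show ?thesis using q_hol 3 by simp
    next
      case 4
      then have "W i j = (\<lambda>\<theta>. csqrt (q i \<theta>))" using \<open>a \<noteq> b\<close> by (auto simp: W_def J_def fun_eq_iff)
      then show ?thesis using q_hol 4 by simp
    qed (auto simp: W_def)
  qed
  have F_hol: "F holomorphic_on Sg"
  proof -
    have "(\<lambda>\<theta>. E \<theta> i j) holomorphic_on Sg" if "i \<in> I" "j \<in> I" for i j
      unfolding E_def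
    proof (rule kernel_holomorphic')
      show "W i j holomorphic_on Sg" using W_hol[OF that] Sg_U holomorphic_on_subset by blast
      show "W i j z \<noteq> 0" if "z \<in> Sg" for z
      proof (cases "i = a \<and> j = b \<or> i = b \<and> j = a")
        case True
        then have "W i j z = sin z" using \<open>a \<noteq> b\<close> by (auto simp: W_def)
        then show ?thesis using that by (auto simp: Sg_def)
      next
        case False
        then show ?thesis using W_nz[of z i j] that Sg_U \<open>i \<in> I\<close> \<open>j \<in> I\<close> by blast
      qed
    qed
    then show ?thesis unfolding F_def leibniz_det_def
      by (intro holomorphic_on_sum holomorphic_on_mult holomorphic_on_const holomorphic_on_prod)
        (auto simp: permutes_in_image)
  qed
  \<comment> \<open>Identity theorem: the zeros on \<open>line\<close> accumulate at
    \<open>pi / 2\<close>, so \<open>F\<close> vanishes throughout \<open>Sg\<close>, in particular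
    at real \<open>\<theta>\<close> arbitrarily close to the branch point.\<close>
  have F_zero: "F \<theta> = 0" if "\<theta> \<in> Sg" for \<theta>
  proof (rule analytic_continuation[OF F_hol Sg_open Sg_conn line_Sg _ _ F_line that])
    show "complex_of_real (pi / 2) \<in> Sg" using reals_Sg[of "pi / 2"] by simp
    show "complex_of_real (pi / 2) islimpt line"
      unfolding islimpt_approachable
    proof (intro allI impI)
      fix e :: real assume "e > 0"
      then show "\<exists>x'\<in>line. x' \<noteq> complex_of_real (pi / 2) \<and> dist x' (complex_of_real (pi / 2)) < e"
      proof (intro bexI conjI)
        show "of_real (pi / 2) + \<i> * of_real (e / 2) \<in> line" unfolding line_def by blast
      qed (use \<open>e > 0\<close> in \<open>simp_all add: dist_norm norm_mult\<close>)
    qed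
  qed

  obtain k c where kc: "k > 0" "c \<noteq> 0" "((\<lambda>w. w^k * (lc w * kc w)) \<longlongrightarrow> c) (at 0)"
    using pole by blast
  define s where "s t = complex_of_real (sin t)" for t :: real
  have s_lim: "(s \<longlongrightarrow> 0) (at 0)"
    unfolding s_def by (rule tendsto_eq_intros refl | simp)+
  have s_nz: "\<forall>\<^sub>F t in at 0. sin (t::real) \<noteq> 0"
  proof -
    have "\<forall>\<^sub>F t in at (0::real). t \<in> {-1<..<1} - {0}"
      by (intro eventually_at_in_open) auto
    then show ?thesis
    proof eventually_elim
      case (elim t)
      then show ?case using sin_gt_zero[of t] sin_gt_zero[of "-t"] pi_gt3 by (cases "t > 0") auto
    qed
  qed
  have s_at: "filterlim s (at 0) (at 0)"
    using s_lim s_nz by (auto simp: filterlim_at s_def)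
  \<comment> \<open>Apart from the two coupling entries, \<open>\<theta>\<close> enters only through
    \<open>sin^2 \<theta>\<close> and \<open>cos \<theta>\<close>.\<close>
  have even: "W i j (of_real (-t)) = W i j (of_real t)" if "\<not> (i = a \<and> j = b \<or> i = b \<and> j = a)" for i j t
    using that by (auto simp: W_def q_def)
  define T where "T p t = (\<Prod>i\<in>J. E (of_real t) i (p i))" for p t
  have prod_split: "(\<Prod>i\<in>I. E \<theta> i (p i)) = E \<theta> a (p a) * E \<theta> b (p b) * (\<Prod>i\<in>J. E \<theta> i (p i))" for \<theta> p
  proof -
    have "I = insert a (insert b J)" "a \<notin> J" "b \<notin> J" using I by (auto simp: J_def)
    then show ?thesis using \<open>a \<noteq> b\<close> \<open>finite J\<close> by (simp add: mult_ac)
  qed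
  have E_lim: "((\<lambda>t. E (of_real t) i j) \<longlongrightarrow> E 0 i j) (at 0)"
    if "i \<in> I" "j \<in> I" "\<not> (i = a \<and> j = b \<or> i = b \<and> j = a)" for i j
  proof -
    have "0 \<in> U" using reals_U[of 0] by simp
    have "isCont (W i j) 0"
      using holomorphic_on_imp_continuous_on[OF W_hol[OF that(1,2)]] \<open>open U\<close> \<open>0 \<in> U\<close> continuous_on_eq_continuous_at by blast
    then have "isCont (\<lambda>\<theta>. E \<theta> i j) 0"
      unfolding E_def using kernel_continuous[OF W_nz[OF \<open>0 \<in> U\<close> that]] by (rule isCont_o2)
    moreover have "(complex_of_real \<longlongrightarrow> 0) (at 0)" by (rule tendsto_eq_intros refl | simp)+
    ultimately show ?thesis by (rule isCont_tendsto_compose)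
  qed
  have even_T: "T p (-t) = T p t" for p t
    unfolding T_def E_def by (intro prod.cong refl, subst even) (auto simp: J_def)
  have lim_T: "((\<lambda>t. T p t) \<longlongrightarrow> (\<Prod>i\<in>J. E 0 i (p i))) (at 0)" if "p permutes I" for p
    unfolding T_def by (intro tendsto_prod E_lim) (use that in \<open>auto simp: J_def permutes_in_image\<close>)
  have Eab: "E (of_real t) a b = lc (s t)" "E (of_real t) b a = kc (s t)" for t
    using ab \<open>a \<noteq> b\<close> by (auto simp: E_def W_def s_def kernel_def sin_of_real)
  have s_minus: "s (-t) = - s t" for t by (simp add: s_def)
  \<comment> \<open>Contribution of \<open>p\<close> to the limit of
    \<open>s^k (F(t) + F(-t))\<close>, with \<open>k\<close> the pole order of
    \<open>lc w * kc w\<close>. Only permutations exchanging \<open>a\<close> and \<open>b\<close>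
    survive; their two odd factors have an even product, which gives the 2.\<close>
  let ?A = "\<lambda>p. if p a = b \<and> p b = a then 2 * c * (\<Prod>i\<in>J. entry S X i (p i)) else 0"
  have term_lim: "((\<lambda>t. s t ^ k * ((\<Prod>i\<in>I. E (of_real t) i (p i)) + (\<Prod>i\<in>I. E (of_real (-t)) i (p i)))) \<longlongrightarrow> ?A p) (at 0)"
    if p: "p permutes I" for p
  proof -
    have pI: "p a \<in> I" "p b \<in> I" using p I by (auto simp: permutes_in_image)
    let ?f = "\<lambda>t. s t ^ k * ((\<Prod>i\<in>I. E (of_real t) i (p i)) + (\<Prod>i\<in>I. E (of_real (-t)) i (p i)))"
    have f: "?f t = s t ^ k * (E (of_real t) a (p a) * E (of_real t) b (p b)
         + E (of_real (-t)) a (p a) * E (of_real (-t)) b (p b)) * T p t" for t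
      unfolding prod_split T_def[symmetric] even_T by (simp add: algebra_simps)
    consider "p a = b" "p b = a" | "p a = b" "p b \<noteq> a" | "p a \<noteq> b" "p b = a" | "p a \<noteq> b" "p b \<noteq> a" by blast
    then show ?thesis
    proof cases
      case 1
      have "((\<lambda>t. 2 * (s t ^ k * (lc (s t) * kc (s t))) * T p t) \<longlongrightarrow> 2 * c * (\<Prod>i\<in>J. E 0 i (p i))) (at 0)"
        by (intro tendsto_mult tendsto_const lim_T p filterlim_compose[OF kc(3) s_at])
      moreover have "?f = (\<lambda>t. 2 * (s t ^ k * (lc (s t) * kc (s t))) * T p t)"
        unfolding f fun_eq_iff 1 Eab s_minus kc_odd lc_odd by (simp add: algebra_simps)
      moreover have "(\<Prod>i\<in>J. E 0 i (p i)) = (\<Prod>i\<in>J. entry S X i (p i))"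
      proof (rule prod.cong)
        fix i assume "i \<in> J"
        moreover from this have "p i \<noteq> a" using 1 permutes_inj[OF p] by (metis DiffD2 J_def injD insertI1 insertI2)
        ultimately show "E 0 i (p i) = entry S X i (p i)" by (auto simp: J_def E_def W_def entry_def)
      qed simp
      ultimately show ?thesis using 1 by simp
    next
      case 2
      \<comment> \<open>With exactly one coupling entry present the product is odd in
        \<open>t\<close>, so symmetrisation cancels it whatever the size of the singularity.\<close>
      have "E (of_real (-t)) b (p b) = E (of_real t) b (p b)" for t
        using 2 \<open>a \<noteq> b\<close> even[of b "p b"] by (simp add: E_def)
      then have "?f = (\<lambda>t. 0)" unfolding f fun_eq_iff 2 Eab s_minus lc_odd by (simp add: algebra_simps)
      then show ?thesis using 2 by simp
    next
      case 3
      have "E (of_real (-t)) a (p a) = E (of_real t) a (p a)" for t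
        using 3 \<open>a \<noteq> b\<close> even[of a "p a"] by (simp add: E_def)
      then have "?f = (\<lambda>t. 0)" unfolding f fun_eq_iff 3 Eab s_minus kc_odd by (simp add: algebra_simps)
      then show ?thesis using 3 by simp
    next
      case 4
      have "E (of_real (-t)) a (p a) = E (of_real t) a (p a)" "E (of_real (-t)) b (p b) = E (of_real t) b (p b)" for t
        using 4 \<open>a \<noteq> b\<close> even[of a "p a"] even[of b "p b"] by (simp_all add: E_def)
      then have "?f = (\<lambda>t. s t ^ k * (2 * (E (of_real t) a (p a) * E (of_real t) b (p b)) * T p t))"
        unfolding f fun_eq_iff by (simp add: algebra_simps)
      \<comment> \<open>Without coupling entries every factor has a finite limit, and
        \<open>k > 0\<close> makes \<open>s t ^ k\<close> tend to 0.\<close>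
      moreover have "((\<lambda>t. s t ^ k * (2 * (E (of_real t) a (p a) * E (of_real t) b (p b)) * T p t)) \<longlongrightarrow>
         0 ^ k * (2 * (E 0 a (p a) * E 0 b (p b)) * (\<Prod>i\<in>J. E 0 i (p i)))) (at 0)"
        by (intro tendsto_mult tendsto_const tendsto_power s_lim lim_T p E_lim)
          (use I 4 pI \<open>a \<noteq> b\<close> in auto)
      ultimately show ?thesis using 4 kc(1) by (simp add: zero_power)
    qed
  qed
  have "((\<lambda>t. \<Sum>p | p permutes I. of_int (sign p) * (s t ^ k *
       ((\<Prod>i\<in>I. E (of_real t) i (p i)) + (\<Prod>i\<in>I. E (of_real (-t)) i (p i))))) \<longlongrightarrow>
       (\<Sum>p | p permutes I. of_int (sign p) * ?A p)) (at 0)"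
    by (intro tendsto_sum tendsto_mult tendsto_const term_lim) auto
  also have "(\<lambda>t. \<Sum>p | p permutes I. of_int (sign p) * (s t ^ k *
       ((\<Prod>i\<in>I. E (of_real t) i (p i)) + (\<Prod>i\<in>I. E (of_real (-t)) i (p i)))))
     = (\<lambda>t. s t ^ k * (F (of_real t) + F (of_real (-t))))"
    unfolding F_def leibniz_det_def fun_eq_iff
    by (simp add: sum_distrib_left sum.distrib[symmetric] algebra_simps)
  also have "(\<Sum>p | p permutes I. of_int (sign p) * ?A p)
     = 2 * c * (\<Sum>p | p permutes I \<and> p a = b \<and> p b = a. of_int (sign p) * (\<Prod>i\<in>I - {a, b}. entry S X i (p i)))"
    unfolding J_def using I by (subst sum_distrib_left, intro sum.mono_neutral_cong_right)
      (auto simp: finite_permutations)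
  also have "\<dots> = - (2 * c * leibniz_det (I - {a, b}) (entry S X))"
    using I \<open>a \<noteq> b\<close> by (subst leibniz_det_swapping) auto
  finally have lim: "((\<lambda>t. s t ^ k * (F (of_real t) + F (of_real (-t)))) \<longlongrightarrow>
     - (2 * c * leibniz_det (I - {a, b}) (entry S X))) (at 0)" .
  have ev0: "\<forall>\<^sub>F t in at 0. s t ^ k * (F (of_real t) + F (of_real (-t))) = 0"
    using s_nz
  proof eventually_elim
    case (elim t)
    then have "F (of_real t) = 0" "F (of_real (-t)) = 0"
      using F_zero[OF reals_Sg[of t]] F_zero[OF reals_Sg[of "-t"]] by auto
    then show ?case by simp
  qed
  have "((\<lambda>t. 0) \<longlongrightarrow> - (2 * c * leibniz_det (I - {a, b}) (entry S X))) (at (0::real))"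
    using lim tendsto_cong[OF ev0] by simp
  then have "- (2 * c * leibniz_det (I - {a, b}) (entry S X)) = 0"
    by (simp add: tendsto_const_iff)
  then show False using nz kc(2) by simp
qed

section \<open>Induction on the interior points and transfer to the Kansa matrix\<close>

text \<open>Induction on \<open>S\<close> with \<open>m\<close> arbitrary. Adding \<open>a\<close>
  leads back to \<open>S\<close> with one boundary point fewer, or to \<open>S\<close> alone when
  \<open>m = 0\<close>; hence the base case is demanded for all \<open>m' \<le> m\<close>. Removing
  the last boundary point keeps the boundary indices an initial segment.\<close>

lemma AE_nonsingular:
  fixes M :: "'a::euclidean_space measure" and Q :: "nat \<Rightarrow> 'a"
  assumes M: "prob_space M" "sets M = sets borel" and ac: "\<And>R. (AE x in lborel. R x) \<Longrightarrow> (AE x in M. R x)"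
    and base: "\<And>m'. m' \<le> m \<Longrightarrow> leibniz_det {0..<m'} (entry {} Q) \<noteq> 0"
    and Q: "inj_on Q {0..<m}" and S: "finite S" "S \<inter> {0..<m} = {}"
  shows "AE P in Pi\<^sub>M S (\<lambda>_. M).
    leibniz_det (S \<union> {0..<m}) (entry S (\<lambda>i. if i \<in> S then P i else Q i)) \<noteq> 0"
  using S base Q
proof (induction S arbitrary: m rule: finite_induct)
  case empty
  then show ?case by simp
next
  case (insert a S)
  interpret M: prob_space M by (rule M)
  interpret product_sigma_finite "\<lambda>_::nat. M" by unfold_locales
  note [measurable_cong] = M(2)
  define X where "X P i = (if i \<in> S then P i else Q i)" for P i
  have X: "(\<lambda>i. if i \<in> insert a S then (P(a := y)) i else Q i) = (X P)(a := y)" for P y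
    using insert by (auto simp: X_def fun_eq_iff)
  let ?D = "\<lambda>x. leibniz_det (insert a S \<union> {0..<m}) (entry (insert a S) x)"
  have entry_eq: "leibniz_det I (entry (insert a S) x) = leibniz_det I (entry S x)" if "a \<notin> I" for I x
    using that by (intro leibniz_det_cong) (auto simp: entry_def kernel_def)
  \<comment> \<open>One good position of the new point suffices: \<open>AE_point\<close> turns it
    into almost every position.\<close>
  have ex: "AE P in Pi\<^sub>M S (\<lambda>_. M). \<exists>y. ?D ((X P)(a := y)) \<noteq> 0"
  proof (cases m)
    case 0
    have "AE P in Pi\<^sub>M S (\<lambda>_. M). leibniz_det (S \<union> {0..<0}) (entry S (X P)) \<noteq> 0"
      unfolding X_def using insert 0 by (intro insert.IH) auto
    then show ?thesis
    proof eventually_elim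
      case (elim P)
      then show ?case using exists_far_point[of S a "X P"] insert 0 by simp
    qed
  next
    case (Suc m')
    have "AE P in Pi\<^sub>M S (\<lambda>_. M). leibniz_det (S \<union> {0..<m'}) (entry S (X P)) \<noteq> 0"
      unfolding X_def using insert Suc
      by (intro insert.IH) (auto intro: inj_on_subset)
    \<comment> \<open>The law \<open>M\<close> charges no single point, so the interior points
      almost surely avoid the boundary point about to be removed.\<close>
    moreover have "AE P in Pi\<^sub>M S (\<lambda>_. M). \<forall>i\<in>S. P i \<noteq> Q m'"
    proof (rule AE_finite_allI)
      fix i assume "i \<in> S"
      show "AE P in Pi\<^sub>M S (\<lambda>_. M). P i \<noteq> Q m'"
        by (rule AE_PiM_component[OF _ \<open>i \<in> S\<close> ac]) (use M AE_lborel_singleton in auto)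
    qed (use insert in auto)
    ultimately show ?thesis
    proof eventually_elim
      case (elim P)
      show ?case
      proof (rule exists_nonsingular_near_branch_point[where b=m'])
        have I: "insert a S \<union> {0..<m} - {a, m'} = S \<union> {0..<m'}"
          using insert Suc by auto
        show "leibniz_det (insert a S \<union> {0..<m} - {a, m'}) (entry (insert a S) (X P)) \<noteq> 0"
          unfolding I using elim(1) insert Suc by (subst entry_eq) auto
        show "X P j \<noteq> X P m'" if "j \<in> insert a S \<union> {0..<m} - {a, m'}" for j
        proof -
          have m': "m' \<notin> S" using insert Suc by auto
          show ?thesis
          proof (cases "j \<in> S")
            case True
            then show ?thesis using elim(2) m' by (simp add: X_def)
          next
            case False
            then have "j < m'" using that unfolding I by auto
            then have "Q j \<noteq> Q m'"
              using inj_onD[OF \<open>inj_on Q {0..<m}\<close>, of j m'] Suc by auto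
            then show ?thesis using False m' by (simp add: X_def)
          qed
        qed
      qed (use insert Suc in auto)
    qed
  qed
  show ?case
  proof (rule AE_PiM_insert)
    have "(\<lambda>P. ?D (\<lambda>i. if i \<in> insert a S then P i else Q i)) \<in> borel_measurable (Pi\<^sub>M (insert a S) (\<lambda>_. M))"
    proof (rule leibniz_det_measurable)
      fix i
      show "(\<lambda>P. if i \<in> insert a S then P i else Q i) \<in> borel_measurable (Pi\<^sub>M (insert a S) (\<lambda>_. M))"
        by (cases "i \<in> insert a S") (simp_all only: if_True if_False, measurable)
    qed
    then show "Measurable.pred (Pi\<^sub>M (insert a S) (\<lambda>_. M))
        (\<lambda>P. ?D (\<lambda>i. if i \<in> insert a S then P i else Q i) \<noteq> 0)" by measurable
    show "AE P in Pi\<^sub>M S (\<lambda>_. M). AE y in M. ?D (\<lambda>i. if i \<in> insert a S then (P(a := y)) i else Q i) \<noteq> 0"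
      unfolding X using ex
    proof eventually_elim
      case (elim P)
      then show ?case using AE_point by (intro ac) blast
    qed
  qed (use insert in auto)
qed

text \<open>The matrix lists interior points first, the induction lists boundary points first; a
  simultaneous permutation of rows and columns relates the two without changing the
  determinant.\<close>

lemma AE_det_kansa_matrix:
  fixes M :: "'a::euclidean_space measure" and Q :: "nat \<Rightarrow> 'a"
  assumes M: "prob_space M" "sets M = sets borel" and ac: "\<And>R. (AE x in lborel. R x) \<Longrightarrow> (AE x in M. R x)"
    and Q: "inj_on Q {..<m}"
    and phi: "\<And>z::'a. complex_of_real (phi (norm z)) = kc (of_real (mq_weight eps z))"
    and lap: "\<And>x c::'a. complex_of_real (laplacian (\<lambda>x. phi (norm (x - c))) x) = lc (of_real (mq_weight eps (x - c)))"
    and base: "\<And>m'. m' \<le> m \<Longrightarrow> leibniz_det {0..<m'} (\<lambda>i j. phi (norm (Q i - Q j))) \<noteq> 0"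
  shows "AE P in Pi\<^sub>M UNIV (\<lambda>_::nat. M). det (kansa_matrix phi Q m P n) \<noteq> 0"
proof -
  define S where "S = {m..<n + m}"
  \<comment> \<open>\<open>f\<close> sends an index of the new numbering to its matrix index:
    boundary \<open>k < m\<close> to \<open>n + k\<close>, interior \<open>k\<close> to
    \<open>k - m\<close>.\<close>
  define f where "f k = (if k < m then n + k else if k < n + m then k - m else k)" for k
  define Y where "Y P i = (if i < n then P i else Q (i - n))" for P i
  have f: "f permutes {0..<n + m}"
  proof (rule bij_imp_permutes)
    show "bij_betw f {0..<n + m} {0..<n + m}"
      by (rule bij_betwI[where g="\<lambda>k. if k < n then k + m else k - n"]) (auto simp: f_def)
  qed (simp add: f_def)
  have det: "complex_of_real (det (kansa_matrix phi Q m P n))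
      = leibniz_det (S \<union> {0..<m}) (entry S (\<lambda>k. if k \<in> S then P (k - m) else Q k))" for P
  proof -
    let ?K = "\<lambda>i j. complex_of_real (if i < n then laplacian (\<lambda>x. phi (norm (x - Y P j))) (P i)
         else phi (norm (Q (i - n) - Y P j)))"
    have "complex_of_real (det (kansa_matrix phi Q m P n)) = leibniz_det {0..<n + m} ?K"
      unfolding kansa_matrix_def det_eq_leibniz_det leibniz_det_of_real[symmetric]
      by (rule leibniz_det_cong) (simp add: Let_def Y_def)
    also have "\<dots> = leibniz_det {0..<n + m} (entry {..<n} (Y P))"
      by (rule leibniz_det_cong) (auto simp: entry_def kernel_def phi lap, auto simp: Y_def)
    also have "\<dots> = leibniz_det {0..<n + m} (\<lambda>i j. entry {..<n} (Y P) (f i) (f j))"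
      by (rule leibniz_det_reindex[OF _ f, symmetric]) simp
    also have "\<dots> = leibniz_det {0..<n + m} (entry S (\<lambda>k. if k \<in> S then P (k - m) else Q k))"
      by (rule leibniz_det_cong) (auto simp: entry_def kernel_def Y_def f_def S_def)
    also have "{0..<n + m} = S \<union> {0..<m}" by (auto simp: S_def)
    finally show ?thesis .
  qed
  let ?D = "\<lambda>P'. leibniz_det (S \<union> {0..<m}) (entry S (\<lambda>k. if k \<in> S then P' k else Q k))"
  have "AE P' in Pi\<^sub>M S (\<lambda>_. M). ?D P' \<noteq> 0"
  proof (rule AE_nonsingular[OF M ac])
    show "leibniz_det {0..<m'} (entry {} Q) \<noteq> 0" if "m' \<le> m" for m'
    proof -
      have "entry {} Q = (\<lambda>i j. complex_of_real (phi (norm (Q i - Q j))))"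
        by (simp add: entry_def kernel_def phi fun_eq_iff)
      then show ?thesis using base[OF that] by (simp add: leibniz_det_of_real)
    qed
    show "inj_on Q {0..<m}" using Q by (simp add: atLeast0LessThan)
  qed (auto simp: S_def)
  \<comment> \<open>The determinant sees finitely many coordinates; shifted by \<open>m\<close>,
    they have the finite product as their joint law.\<close>
  also have "Pi\<^sub>M S (\<lambda>_. M) = distr (Pi\<^sub>M UNIV (\<lambda>_::nat. M)) (Pi\<^sub>M S (\<lambda>_. M)) (\<lambda>P. \<lambda>k\<in>S. P (k - m))"
    by (rule distr_PiM_reindex[symmetric, where M="\<lambda>_. M"]) (use M in \<open>auto simp: S_def inj_on_def\<close>)
  finally have "AE P in Pi\<^sub>M UNIV (\<lambda>_::nat. M). ?D (\<lambda>k\<in>S. P (k - m)) \<noteq> 0"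
    by (rule AE_distrD[rotated]) measurable
  then show ?thesis
  proof eventually_elim
    case (elim P)
    have "?D (\<lambda>k\<in>S. P (k - m)) = complex_of_real (det (kansa_matrix phi Q m P n))"
      unfolding det by (rule leibniz_det_cong) (auto simp: entry_def)
    then show ?case using elim by auto
  qed
qed

end

section \<open>Nonsingularity for boundary points only\<close>

text \<open>Schur products of a Gram matrix are positive semidefinite: one inner product is expanded
  over the basis and its coordinates are absorbed into the weights, hence the induction with
  \<open>d\<close> arbitrary.\<close>

lemma sum_inner_power_nonneg:
  fixes x :: "'i \<Rightarrow> 'a::euclidean_space"
  shows "0 \<le> (\<Sum>i\<in>I. \<Sum>j\<in>I. d i * d j * (x i \<bullet> x j) ^ k)"
proof (induction k arbitrary: d)
  case 0
  have "(\<Sum>i\<in>I. \<Sum>j\<in>I. d i * d j) = (\<Sum>i\<in>I. d i)\<^sup>2"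
    by (simp add: power2_eq_square sum_product)
  then show ?case by simp
next
  case (Suc k)
  have "(\<Sum>i\<in>I. \<Sum>j\<in>I. d i * d j * (x i \<bullet> x j) ^ Suc k)
      = (\<Sum>i\<in>I. \<Sum>j\<in>I. \<Sum>b\<in>Basis. (d i * (x i \<bullet> b)) * (d j * (x j \<bullet> b)) * (x i \<bullet> x j) ^ k)"
    unfolding power_Suc
    by (intro sum.cong refl, subst euclidean_inner) (simp add: sum_distrib_left sum_distrib_right mult_ac)
  also have "\<dots> = (\<Sum>i\<in>I. \<Sum>b\<in>Basis. \<Sum>j\<in>I. (d i * (x i \<bullet> b)) * (d j * (x j \<bullet> b)) * (x i \<bullet> x j) ^ k)"
    by (intro sum.cong refl sum.swap)
  also have "\<dots> = (\<Sum>b\<in>Basis. \<Sum>i\<in>I. \<Sum>j\<in>I. (d i * (x i \<bullet> b)) * (d j * (x j \<bullet> b)) * (x i \<bullet> x j) ^ k)"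
    by (rule sum.swap)
  also have "\<dots> \<ge> 0" by (intro sum_nonneg Suc)
  finally show ?case .
qed

text \<open>After the factors depending on one point are absorbed into the weights,
  \<open>exp (2 u (x \<bullet> y))\<close> is a power series in the inner product with nonnegative
  coefficients.\<close>

lemma gaussian_form_nonneg:
  fixes x :: "'i \<Rightarrow> 'a::euclidean_space"
  assumes u: "u \<ge> 0"
  shows "0 \<le> (\<Sum>i\<in>I. \<Sum>j\<in>I. c i * c j * exp (- u * (norm (x i - x j))\<^sup>2))"
proof -
  define d where "d i = c i * exp (- u * (norm (x i))\<^sup>2)" for i
  have "c i * c j * exp (- u * (norm (x i - x j))\<^sup>2) = d i * d j * exp (2 * u * (x i \<bullet> x j))" for i j
  proof -
    have *: "- u * (norm (x i - x j))\<^sup>2 = - u * (norm (x i))\<^sup>2 + - u * (norm (x j))\<^sup>2 + 2 * u * (x i \<bullet> x j)"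
      unfolding power2_norm_eq_inner by (simp add: inner_diff_left inner_diff_right inner_commute algebra_simps)
    show ?thesis unfolding * exp_add d_def by (simp add: mult_ac)
  qed
  moreover have "0 \<le> (\<Sum>i\<in>I. \<Sum>j\<in>I. d i * d j * exp (2 * u * (x i \<bullet> x j)))"
  proof (rule sums_le[OF _ sums_zero])
    show "(\<lambda>k. \<Sum>i\<in>I. \<Sum>j\<in>I. d i * d j * ((2 * u * (x i \<bullet> x j)) ^ k /\<^sub>R fact k)) sums
      (\<Sum>i\<in>I. \<Sum>j\<in>I. d i * d j * exp (2 * u * (x i \<bullet> x j)))"
      by (intro sums_sum sums_mult exp_converges)
    fix k
    have "(\<Sum>i\<in>I. \<Sum>j\<in>I. d i * d j * ((2 * u * (x i \<bullet> x j)) ^ k /\<^sub>R fact k))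
       = ((2 * u) ^ k / fact k) * (\<Sum>i\<in>I. \<Sum>j\<in>I. d i * d j * (x i \<bullet> x j) ^ k)"
      by (simp add: sum_distrib_left power_mult_distrib field_simps)
    also have "\<dots> \<ge> 0" using u by (intro mult_nonneg_nonneg sum_inner_power_nonneg) auto
    finally show "0 \<le> (\<Sum>i\<in>I. \<Sum>j\<in>I. d i * d j * ((2 * u * (x i \<bullet> x j)) ^ k /\<^sub>R fact k))" .
  qed
  ultimately show ?thesis by simp
qed

text \<open>A rescaled normal density of variance \<open>1 / (2 s)\<close>.\<close>

lemma has_bochner_integral_gaussian:
  assumes s: "(s::real) > 0"
  shows "has_bochner_integral lborel (\<lambda>u. exp (- s * u\<^sup>2)) (sqrt (pi / s))"
proof -
  let ?\<sigma> = "1 / sqrt (2 * s)"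
  have \<sigma>: "?\<sigma>\<^sup>2 = 1 / (2 * s)" "?\<sigma> > 0" using s by (simp_all add: power_divide)
  have "has_bochner_integral lborel (\<lambda>u. sqrt (pi / s) * normal_density 0 ?\<sigma> u) (sqrt (pi / s) * 1)"
    using \<sigma>(2) by (intro has_bochner_integral_mult_right) (simp add: has_bochner_integral_iff)
  moreover have "sqrt (pi / s) * normal_density 0 ?\<sigma> u = exp (- s * u\<^sup>2)" for u
    using s unfolding normal_density_def \<sigma>(1) by (simp add: real_sqrt_divide field_simps)
  ultimately show ?thesis by simp
qed

text \<open>Since \<open>1 / sqrt s\<close> is, up to the factor \<open>sqrt pi\<close>, the
  integral of \<open>exp (- s u^2)\<close>, the form is an integral of nonnegative Gaussian forms.
  The shift \<open>\<tau>\<close> serves the derivative argument for the multiquadric.\<close>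

lemma inverse_multiquadric_form_pos:
  fixes x :: "nat \<Rightarrow> 'a::euclidean_space"
  assumes I: "finite I" "inj_on x I" and c: "\<exists>i\<in>I. c i \<noteq> 0" and eps: "eps > 0" and \<tau>: "\<tau> > 0"
  shows "0 < (\<Sum>i\<in>I. \<Sum>j\<in>I. c i * c j / sqrt (\<tau> + (eps * norm (x i - x j))\<^sup>2))"
proof -
  let ?s = "\<lambda>i j. \<tau> + (eps * norm (x i - x j))\<^sup>2"
  let ?T = "\<Sum>i\<in>I. \<Sum>j\<in>I. c i * c j / sqrt (?s i j)"
  let ?G = "\<lambda>u::real. \<Sum>i\<in>I. \<Sum>j\<in>I. c i * c j * exp (- (u\<^sup>2 * eps\<^sup>2) * (norm (x i - x j))\<^sup>2)"
  define h where "h u = (\<Sum>i\<in>I. \<Sum>j\<in>I. c i * c j * exp (- ?s i j * u\<^sup>2))" for u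
  have s: "?s i j > 0" for i j using \<tau> by (simp add: add_pos_nonneg)
  have hG: "h u = exp (- \<tau> * u\<^sup>2) * ?G u" for u
  proof -
    have "exp (- ?s i j * u\<^sup>2) = exp (- \<tau> * u\<^sup>2) * exp (- (u\<^sup>2 * eps\<^sup>2) * (norm (x i - x j))\<^sup>2)" for i j
      unfolding exp_add[symmetric] by (simp add: algebra_simps power_mult_distrib)
    then show ?thesis unfolding h_def sum_distrib_left by (simp add: mult_ac)
  qed
  have hb: "has_bochner_integral lborel h (\<Sum>i\<in>I. \<Sum>j\<in>I. c i * c j * sqrt (pi / ?s i j))"
    unfolding h_def
    by (rule has_bochner_integral_sum, rule has_bochner_integral_sum,
        rule has_bochner_integral_mult_right, rule has_bochner_integral_gaussian, rule s)
  have eq: "(\<Sum>i\<in>I. \<Sum>j\<in>I. c i * c j * sqrt (pi / ?s i j)) = sqrt pi * ?T"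
    by (simp add: sum_distrib_left real_sqrt_divide mult_ac)
  have h_nonneg: "h u \<ge> 0" for u
    unfolding hG using gaussian_form_nonneg[of "u\<^sup>2 * eps\<^sup>2" c x I] by simp
  \<comment> \<open>For large \<open>u\<close> the Gaussian matrix approaches the identity, so the
    integrand is strictly positive on a half-line.\<close>
  have "(?G \<longlongrightarrow> (\<Sum>i\<in>I. \<Sum>j\<in>I. c i * c j * (if i = j then 1 else 0))) at_top"
  proof (intro tendsto_sum tendsto_mult tendsto_const)
    fix i j assume ij: "i \<in> I" "j \<in> I"
    show "((\<lambda>u. exp (- (u\<^sup>2 * eps\<^sup>2) * (norm (x i - x j))\<^sup>2)) \<longlongrightarrow> (if i = j then 1 else 0)) at_top"
    proof (cases "i = j")
      case False
      then have "norm (x i - x j) > 0" using inj_onD[OF I(2)] ij by auto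
      then have "((\<lambda>u. exp (- (u\<^sup>2 * eps\<^sup>2) * (norm (x i - x j))\<^sup>2)) \<longlongrightarrow> 0) at_top"
        using eps by real_asymp
      then show ?thesis using False by simp
    qed simp
  qed
  also have "(\<Sum>i\<in>I. \<Sum>j\<in>I. c i * c j * (if i = j then 1 else 0)) = (\<Sum>i\<in>I. (c i)\<^sup>2)"
    using I by (intro sum.cong refl) (simp add: if_distrib sum.delta power2_eq_square cong: if_cong)
  finally have "(?G \<longlongrightarrow> (\<Sum>i\<in>I. (c i)\<^sup>2)) at_top" .
  moreover have "(\<Sum>i\<in>I. (c i)\<^sup>2) > 0"
  proof -
    obtain i where "i \<in> I" "c i \<noteq> 0" using c by blast
    then show ?thesis by (intro sum_pos2[OF I(1)]) auto
  qed
  ultimately have "\<forall>\<^sub>F u in at_top. ?G u > 0" by (rule order_tendstoD(1))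
  then obtain U where U: "\<And>u. u \<ge> U \<Longrightarrow> ?G u > 0" by (auto simp: eventually_at_top_linorder)
  have h_pos: "h u > 0" if "u \<ge> U" for u unfolding hG using U[OF that] by simp
  have "integral\<^sup>L lborel h > 0"
  proof (rule ccontr)
    assume "\<not> ?thesis"
    moreover have "integral\<^sup>L lborel h \<ge> 0" by (intro Bochner_Integration.integral_nonneg h_nonneg)
    ultimately have "integral\<^sup>L lborel h = 0" by linarith
    then have "AE u in lborel. h u = 0"
      using hb h_nonneg integral_nonneg_eq_0_iff_AE[of lborel h] by (simp add: has_bochner_integral_iff)
    then have "AE u in lborel. u \<notin> {U..U + 1}"
      by (rule AE_mp) (use h_pos in \<open>force intro!: AE_I2\<close>)
    then have "{U..U + 1} \<in> null_sets lborel" by (subst AE_iff_null_sets) auto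
    then show False by (simp add: null_sets_def)
  qed
  then have "sqrt pi * ?T > 0" using hb eq by (simp add: has_bochner_integral_iff)
  then show ?thesis by (simp add: zero_less_mult_iff)
qed

text \<open>In the shape parameter \<open>\<tau>\<close> the form below has derivative half the inverse multiquadric form
  and tends to \<open>0\<close> at infinity, so it is negative.\<close>

lemma multiquadric_form_neg:
  fixes x :: "nat \<Rightarrow> 'a::euclidean_space"
  assumes I: "finite I" "inj_on x I" and c: "\<exists>i\<in>I. c i \<noteq> 0" "(\<Sum>i\<in>I. c i) = 0" and eps: "eps > 0"
  shows "(\<Sum>i\<in>I. \<Sum>j\<in>I. c i * c j * sqrt (1 + (eps * norm (x i - x j))\<^sup>2)) < 0"
proof -
  define r where "r i j = (eps * norm (x i - x j))\<^sup>2" for i j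
  define g where "g \<tau> = (\<Sum>i\<in>I. \<Sum>j\<in>I. c i * c j * sqrt (\<tau> + r i j))" for \<tau>
  have r: "r i j \<ge> 0" for i j by (simp add: r_def)
  have inc: "g a < g b" if "0 < a" "a < b" for a b
  proof (rule DERIV_pos_imp_increasing[OF \<open>a < b\<close>])
    fix \<tau> assume "a \<le> \<tau>" "\<tau> \<le> b"
    then have \<tau>: "\<tau> > 0" using that by simp
    have "(g has_real_derivative (\<Sum>i\<in>I. \<Sum>j\<in>I. c i * c j * (inverse (sqrt (\<tau> + r i j)) / 2))) (at \<tau>)"
      unfolding g_def
    proof (intro DERIV_sum DERIV_cmult)
      fix i j
      have "\<tau> + r i j > 0" using \<tau> r[of i j] by linarith
      then show "((\<lambda>\<tau>. sqrt (\<tau> + r i j)) has_real_derivative inverse (sqrt (\<tau> + r i j)) / 2) (at \<tau>)"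
        by (auto intro!: derivative_eq_intros)
    qed
    also have "(\<Sum>i\<in>I. \<Sum>j\<in>I. c i * c j * (inverse (sqrt (\<tau> + r i j)) / 2))
       = (\<Sum>i\<in>I. \<Sum>j\<in>I. c i * c j / sqrt (\<tau> + (eps * norm (x i - x j))\<^sup>2)) / 2"
      by (simp add: r_def sum_divide_distrib field_simps)
    finally show "\<exists>y. (g has_real_derivative y) (at \<tau>) \<and> 0 < y"
      using inverse_multiquadric_form_pos[OF I c(1) eps \<tau>] by (meson half_gt_zero)
  qed
  have "(g \<longlongrightarrow> 0) at_top"
  proof -
    \<comment> \<open>The coefficients sum to 0, so \<open>sqrt \<tau>\<close> may be subtracted
      from every entry; the differences tend to 0.\<close>
    have "g = (\<lambda>\<tau>. \<Sum>i\<in>I. \<Sum>j\<in>I. c i * c j * (sqrt (\<tau> + r i j) - sqrt \<tau>))"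
    proof
      fix \<tau>
      have "(\<Sum>i\<in>I. \<Sum>j\<in>I. c i * c j * sqrt \<tau>) = 0"
        using c(2) by (simp add: sum_distrib_right[symmetric] sum_distrib_left[symmetric])
      then show "g \<tau> = (\<Sum>i\<in>I. \<Sum>j\<in>I. c i * c j * (sqrt (\<tau> + r i j) - sqrt \<tau>))"
        by (simp add: g_def right_diff_distrib sum_subtractf)
    qed
    moreover have "((\<lambda>\<tau>. \<Sum>i\<in>I. \<Sum>j\<in>I. c i * c j * (sqrt (\<tau> + r i j) - sqrt \<tau>)) \<longlongrightarrow>
       (\<Sum>i\<in>I. \<Sum>j\<in>I. c i * c j * 0)) at_top"
    proof (intro tendsto_sum tendsto_mult tendsto_const)
      fix i j
      show "((\<lambda>\<tau>. sqrt (\<tau> + r i j) - sqrt \<tau>) \<longlongrightarrow> 0) at_top" by real_asymp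
    qed
    ultimately show ?thesis by simp
  qed
  \<comment> \<open>Monotonicity puts \<open>g 2\<close> below the limit 0; comparing
    \<open>g 1\<close> with \<open>g 2\<close> makes the inequality strict.\<close>
  moreover have "\<forall>\<^sub>F \<tau> in at_top. g 2 \<le> g \<tau>"
    using inc[of 2] by (intro eventually_mono[OF eventually_gt_at_top[of 2]]) (simp add: less_imp_le)
  ultimately have "g 2 \<le> 0" by (rule tendsto_lowerbound) simp
  moreover have "g 1 < g 2" by (rule inc) auto
  ultimately show ?thesis by (simp add: g_def r_def)
qed

lemma leibniz_det_nonzeroI:
  fixes A :: "nat \<Rightarrow> nat \<Rightarrow> real"
  assumes "\<And>c. (\<exists>i\<in>{0..<m}. c i \<noteq> 0) \<Longrightarrow> (\<And>i. i \<in> {0..<m} \<Longrightarrow> (\<Sum>j\<in>{0..<m}. A i j * c j) = 0) \<Longrightarrow> False"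
  shows "leibniz_det {0..<m} A \<noteq> 0"
proof
  assume "leibniz_det {0..<m} A = 0"
  then have "det (mat m m (\<lambda>(i, j). A i j)) = 0" by (simp add: det_eq_leibniz_det)
  then obtain v where v: "v \<in> carrier_vec m" "v \<noteq> 0\<^sub>v m" "mat m m (\<lambda>(i, j). A i j) *\<^sub>v v = 0\<^sub>v m"
    using det_0_iff_vec_prod_zero_field[of "mat m m (\<lambda>(i, j). A i j)" m] by auto
  show False
  proof (rule assms[of "\<lambda>i. vec_index v i"])
    show "\<exists>i\<in>{0..<m}. vec_index v i \<noteq> 0"
      using v(1,2) by (metis atLeastLessThan_iff carrier_vecD eq_vecI index_zero_vec zero_le)
    fix i assume i: "i \<in> {0..<m}"
    have "vec_index (mat m m (\<lambda>(i, j). A i j) *\<^sub>v v) i = 0" using v(3) i by simp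
    then show "(\<Sum>j\<in>{0..<m}. A i j * vec_index v j) = 0"
      using i v(1) by (auto simp: scalar_prod_def carrier_vecD)
  qed
qed

lemma inverse_multiquadric_nonsingular:
  fixes x :: "nat \<Rightarrow> 'a::euclidean_space"
  assumes x: "inj_on x {0..<m}" and eps: "eps > 0"
  shows "leibniz_det {0..<m} (\<lambda>i j. 1 / sqrt (1 + (eps * norm (x i - x j))\<^sup>2)) \<noteq> 0"
proof (rule leibniz_det_nonzeroI)
  fix c :: "nat \<Rightarrow> real"
  assume c: "\<exists>i\<in>{0..<m}. c i \<noteq> 0"
    and z: "\<And>i. i \<in> {0..<m} \<Longrightarrow> (\<Sum>j\<in>{0..<m}. 1 / sqrt (1 + (eps * norm (x i - x j))\<^sup>2) * c j) = 0"
  have "(\<Sum>i\<in>{0..<m}. \<Sum>j\<in>{0..<m}. c i * c j / sqrt (1 + (eps * norm (x i - x j))\<^sup>2))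
      = (\<Sum>i\<in>{0..<m}. c i * (\<Sum>j\<in>{0..<m}. 1 / sqrt (1 + (eps * norm (x i - x j))\<^sup>2) * c j))"
    by (simp add: sum_distrib_left)
  also have "\<dots> = 0" using z by (intro sum.neutral ballI) (simp only: mult_zero_right)
  finally show False using inverse_multiquadric_form_pos[OF _ x c eps, of 1] by simp
qed

text \<open>The form is negative definite on vectors of sum 0. A kernel vector outside this
  hyperplane would correct a unit vector into one of sum 0 without affecting its form value, which
  is positive.\<close>

lemma multiquadric_nonsingular:
  fixes x :: "nat \<Rightarrow> 'a::euclidean_space"
  assumes x: "inj_on x {0..<m}" and eps: "eps > 0"
  shows "leibniz_det {0..<m} (\<lambda>i j. sqrt (1 + (eps * norm (x i - x j))\<^sup>2)) \<noteq> 0"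
proof (rule leibniz_det_nonzeroI)
  fix c :: "nat \<Rightarrow> real"
  define A where "A i j = sqrt (1 + (eps * norm (x i - x j))\<^sup>2)" for i j
  have A: "A i j = A j i" "A i i = 1" for i j by (simp_all add: A_def norm_minus_commute)
  assume c: "\<exists>i\<in>{0..<m}. c i \<noteq> 0"
    and z': "\<And>i. i \<in> {0..<m} \<Longrightarrow> (\<Sum>j\<in>{0..<m}. sqrt (1 + (eps * norm (x i - x j))\<^sup>2) * c j) = 0"
  have z: "(\<Sum>j\<in>{0..<m}. A i j * c j) = 0" if "i \<in> {0..<m}" for i using z'[OF that] by (simp add: A_def)
  have neg: "(\<Sum>i\<in>{0..<m}. \<Sum>j\<in>{0..<m}. w i * w j * A i j) < 0"
    if "\<exists>i\<in>{0..<m}. w i \<noteq> 0" "(\<Sum>i\<in>{0..<m}. w i) = 0" for w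
    unfolding A_def by (rule multiquadric_form_neg[OF _ x that eps]) simp
  have form: "(\<Sum>i\<in>{0..<m}. \<Sum>j\<in>{0..<m}. w i * w j * A i j) = (\<Sum>i\<in>{0..<m}. w i * (\<Sum>j\<in>{0..<m}. A i j * w j))" for w
    by (simp add: sum_distrib_left mult_ac)
  define \<sigma> where "\<sigma> = (\<Sum>i\<in>{0..<m}. c i)"
  show False
  proof (cases "\<sigma> = 0")
    case True
    then show False using neg[OF c] z unfolding form \<sigma>_def by simp
  next
    case False
    have m: "0 \<in> {0..<m}" using c by auto
    \<comment> \<open>The unit vector at 0 minus the kernel vector scaled to sum 1: \<open>w\<close>
      has sum 0, and its form value is \<open>A 0 0 = 1\<close>.\<close>
    define w where "w i = (if i = 0 then 1 else 0) - c i / \<sigma>" for i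
    have "(\<Sum>i\<in>{0..<m}. w i) = 0"
      using m False by (simp add: w_def sum_subtractf sum_divide_distrib[symmetric] \<sigma>_def[symmetric])
    then have le: "(\<Sum>i\<in>{0..<m}. \<Sum>j\<in>{0..<m}. w i * w j * A i j) \<le> 0"
      using neg[of w] by (cases "\<exists>i\<in>{0..<m}. w i \<noteq> 0") (simp_all add: less_imp_le)
    have delta: "(\<Sum>j\<in>{0..<m}. A i j * w j) = A i 0" if "i \<in> {0..<m}" for i
    proof -
      have "(\<Sum>j\<in>{0..<m}. A i j * w j) = (\<Sum>j\<in>{0..<m}. if j = 0 then A i j else 0) - (\<Sum>j\<in>{0..<m}. A i j * c j) / \<sigma>"
        unfolding sum_divide_distrib sum_subtractf[symmetric] by (intro sum.cong) (auto simp: w_def algebra_simps)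
      then show ?thesis using m z[OF that] by simp
    qed
    have "(\<Sum>i\<in>{0..<m}. w i * (\<Sum>j\<in>{0..<m}. A i j * w j)) = (\<Sum>i\<in>{0..<m}. A 0 i * w i)"
      by (rule sum.cong) (simp_all add: delta A(1)[of _ 0])
    also have "\<dots> = 1" using delta[OF m] A by simp
    finally show False using le unfolding form by simp
  qed
qed

section \<open>The Laplacians of the multiquadrics\<close>

lemma mq_weight_line_deriv:
  fixes y b :: "'a::euclidean_space"
  assumes b: "b \<in> Basis"
  shows "((\<lambda>t. mq_weight eps (y + t *\<^sub>R b)) has_real_derivative
     eps\<^sup>2 * (y \<bullet> b + t) * inverse (mq_weight eps (y + t *\<^sub>R b))) (at t)"
proof -
  have q: "(\<lambda>t. mq_weight eps (y + t *\<^sub>R b)) = (\<lambda>t. sqrt (1 + eps\<^sup>2 * ((norm y)\<^sup>2 + 2 * t * (y \<bullet> b) + t\<^sup>2)))"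
    using b by (simp add: mq_weight_def power_mult_distrib norm_add_scaleR_power2 norm_Basis)
  have "sqrt (1 + eps\<^sup>2 * ((norm y)\<^sup>2 + 2 * t * (y \<bullet> b) + t\<^sup>2)) > 0"
    using mq_weight_pos[of eps "y + t *\<^sub>R b"] by (simp add: fun_cong[OF q])
  then have "1 + eps\<^sup>2 * ((norm y)\<^sup>2 + 2 * t * (y \<bullet> b) + t\<^sup>2) > 0" by simp
  then show ?thesis
    unfolding fun_cong[OF q] unfolding q
    by (auto intro!: derivative_eq_intros simp: field_simps)
qed

lemma sum_Basis_mq_weight:
  fixes y :: "'a::euclidean_space"
  shows "(\<Sum>b\<in>Basis. eps\<^sup>2 * (y \<bullet> b)\<^sup>2) = (mq_weight eps y)\<^sup>2 - 1"
proof -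
  have "(norm y)\<^sup>2 = (\<Sum>b\<in>Basis. (y \<bullet> b)\<^sup>2)"
    unfolding power2_norm_eq_inner by (subst euclidean_inner) (simp add: power2_eq_square)
  moreover have "(mq_weight eps y)\<^sup>2 = 1 + eps\<^sup>2 * (norm y)\<^sup>2"
    by (simp add: mq_weight_def power_mult_distrib)
  ultimately show ?thesis by (simp add: sum_distrib_left)
qed

text \<open>In the sum of second partials the squared coordinates combine to \<open>w^2 - 1\<close>,
  leaving an odd rational function of the weight.\<close>

lemma laplacian_MQ:
  fixes x c :: "'a::euclidean_space" and eps :: real
  defines "w \<equiv> mq_weight eps (x - c)"
  shows "laplacian (\<lambda>x. MQ eps (norm (x - c))) x
    = eps\<^sup>2 * ((real DIM('a) - 1) * inverse w + inverse w ^ 3)"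
proof -
  define y where "y = x - c"
  have w_def': "w = mq_weight eps y" by (simp add: w_def y_def)
  have w: "w > 0" by (simp add: w_def mq_weight_pos)
  have "second_partial (\<lambda>x. MQ eps (norm (x - c))) b x
      = eps\<^sup>2 * inverse w - eps\<^sup>2 * inverse w ^ 3 * (eps\<^sup>2 * (y \<bullet> b)\<^sup>2)" if b: "b \<in> Basis" for b
  proof -
    have f: "(\<lambda>t. MQ eps (norm (x + t *\<^sub>R b - c))) = (\<lambda>t. mq_weight eps (y + t *\<^sub>R b))"
      by (simp add: MQ_def mq_weight_def y_def algebra_simps)
    have 1: "deriv (\<lambda>t. mq_weight eps (y + t *\<^sub>R b)) = (\<lambda>t. eps\<^sup>2 * (y \<bullet> b + t) * inverse (mq_weight eps (y + t *\<^sub>R b)))"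
      using DERIV_imp_deriv[OF mq_weight_line_deriv[OF b]] by blast
    have "((\<lambda>t. eps\<^sup>2 * (y \<bullet> b + t) * inverse (mq_weight eps (y + t *\<^sub>R b))) has_real_derivative
        eps\<^sup>2 * inverse w - eps\<^sup>2 * inverse w ^ 3 * (eps\<^sup>2 * (y \<bullet> b)\<^sup>2)) (at 0)"
      using w mq_weight_pos[of eps y]
      by (auto intro!: derivative_eq_intros mq_weight_line_deriv[OF b] simp: w_def' field_simps power2_eq_square power3_eq_cube)
    then show ?thesis unfolding second_partial_def f 1 by (rule DERIV_imp_deriv)
  qed
  then have "laplacian (\<lambda>x. MQ eps (norm (x - c))) x
     = real DIM('a) * (eps\<^sup>2 * inverse w) - eps\<^sup>2 * inverse w ^ 3 * (\<Sum>b\<in>Basis. eps\<^sup>2 * (y \<bullet> b)\<^sup>2)"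
    unfolding laplacian_def by (simp add: sum_subtractf sum_distrib_left)
  also have "\<dots> = eps\<^sup>2 * ((real DIM('a) - 1) * inverse w + inverse w ^ 3)"
    unfolding sum_Basis_mq_weight w_def'[symmetric] using w by (simp add: field_simps power2_eq_square power3_eq_cube)
  finally show ?thesis .
qed

lemma laplacian_IMQ:
  fixes x c :: "'a::euclidean_space" and eps :: real
  defines "w \<equiv> mq_weight eps (x - c)"
  shows "laplacian (\<lambda>x. IMQ eps (norm (x - c))) x
    = eps\<^sup>2 * ((3 - real DIM('a)) * inverse w ^ 3 - 3 * inverse w ^ 5)"
proof -
  define y where "y = x - c"
  have w_def': "w = mq_weight eps y" by (simp add: w_def y_def)
  have w: "w > 0" by (simp add: w_def mq_weight_pos)
  have "second_partial (\<lambda>x. IMQ eps (norm (x - c))) b x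
      = 3 * eps\<^sup>2 * inverse w ^ 5 * (eps\<^sup>2 * (y \<bullet> b)\<^sup>2) - eps\<^sup>2 * inverse w ^ 3" if b: "b \<in> Basis" for b
  proof -
    have f: "(\<lambda>t. IMQ eps (norm (x + t *\<^sub>R b - c))) = (\<lambda>t. inverse (mq_weight eps (y + t *\<^sub>R b)))"
      by (simp add: IMQ_def mq_weight_def y_def algebra_simps inverse_eq_divide)
    have "((\<lambda>t. inverse (mq_weight eps (y + t *\<^sub>R b))) has_real_derivative
        - (eps\<^sup>2 * (y \<bullet> b + t) * inverse (mq_weight eps (y + t *\<^sub>R b)) ^ 3)) (at t)" for t
      using mq_weight_pos[of eps "y + t *\<^sub>R b"]
      by (auto intro!: derivative_eq_intros mq_weight_line_deriv[OF b] simp: field_simps power3_eq_cube)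
    then have 1: "deriv (\<lambda>t. inverse (mq_weight eps (y + t *\<^sub>R b)))
        = (\<lambda>t. - (eps\<^sup>2 * (y \<bullet> b + t) * inverse (mq_weight eps (y + t *\<^sub>R b)) ^ 3))"
      using DERIV_imp_deriv by blast
    have "((\<lambda>t. - (eps\<^sup>2 * (y \<bullet> b + t) * inverse (mq_weight eps (y + t *\<^sub>R b)) ^ 3)) has_real_derivative
        3 * eps\<^sup>2 * inverse w ^ 5 * (eps\<^sup>2 * (y \<bullet> b)\<^sup>2) - eps\<^sup>2 * inverse w ^ 3) (at 0)"
      using w mq_weight_pos[of eps y]
      by (auto intro!: derivative_eq_intros mq_weight_line_deriv[OF b] simp: w_def' field_simps eval_nat_numeral)
    then show ?thesis unfolding second_partial_def f 1 by (rule DERIV_imp_deriv)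
  qed
  then have "laplacian (\<lambda>x. IMQ eps (norm (x - c))) x
     = 3 * eps\<^sup>2 * inverse w ^ 5 * (\<Sum>b\<in>Basis. eps\<^sup>2 * (y \<bullet> b)\<^sup>2) - real DIM('a) * (eps\<^sup>2 * inverse w ^ 3)"
    unfolding laplacian_def by (simp add: sum_subtractf sum_distrib_left)
  also have "\<dots> = eps\<^sup>2 * ((3 - real DIM('a)) * inverse w ^ 3 - 3 * inverse w ^ 5)"
    unfolding sum_Basis_mq_weight w_def'[symmetric] using w by (simp add: field_simps eval_nat_numeral)
  finally show ?thesis .
qed

section \<open>The two kernels as instances, and almost sure nonsingularity\<close>

text \<open>Here \<open>lc w * kc w\<close> is \<open>eps^2 (d - 1 + w^-2)\<close>: a pole of order
  2 with coefficient \<open>eps^2\<close>. The diagonal value \<open>lc 1 = eps^2 d\<close> is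
  nonzero as \<open>d > 0\<close>.\<close>

lemma kansa_kernel_MQ:
  assumes "eps > 0" "d > 0"
  shows "kansa_kernel eps (\<lambda>w. w) (\<lambda>w. (of_real eps)\<^sup>2 * ((of_nat d - 1) * inverse w + inverse w ^ 3))"
proof
  show "\<exists>k c. 0 < k \<and> c \<noteq> 0 \<and>
     ((\<lambda>w. w ^ k * ((complex_of_real eps)\<^sup>2 * ((of_nat d - 1) * inverse w + inverse w ^ 3) * w)) \<longlongrightarrow> c) (at 0)"
  proof (intro exI conjI)
    have "\<forall>\<^sub>F w in at 0. (complex_of_real eps)\<^sup>2 * ((of_nat d - 1) * w\<^sup>2 + 1)
        = w ^ 2 * ((complex_of_real eps)\<^sup>2 * ((of_nat d - 1) * inverse w + inverse w ^ 3) * w)"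
      by (rule eventually_mono[OF eventually_neq_at_within[of 0]]) (simp add: field_simps eval_nat_numeral)
    moreover have "((\<lambda>w. (complex_of_real eps)\<^sup>2 * ((of_nat d - 1) * w\<^sup>2 + 1)) \<longlongrightarrow> (of_real eps)\<^sup>2) (at 0)"
      by (rule tendsto_eq_intros refl | simp)+
    ultimately show "((\<lambda>w. w ^ 2 * ((complex_of_real eps)\<^sup>2 * ((of_nat d - 1) * inverse w + inverse w ^ 3) * w))
        \<longlongrightarrow> (of_real eps)\<^sup>2) (at 0)" by (rule Lim_transform_eventually[rotated])
  qed (use assms in auto)
  show "((\<lambda>w. (complex_of_real eps)\<^sup>2 * ((of_nat d - 1) * inverse w + inverse w ^ 3)) \<longlongrightarrow> 0) at_infinity"
    by (rule tendsto_eq_intros tendsto_inverse_0 refl | simp)+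
qed (use assms in \<open>auto intro!: holomorphic_intros simp: algebra_simps\<close>)

text \<open>Here \<open>lc w * kc w\<close> is \<open>eps^2 ((3 - d) w^-4 - 3 w^-6)\<close>: a pole
  of order 6 with coefficient \<open>-3 eps^2\<close>, in every dimension. The diagonal value is
  \<open>lc 1 = - eps^2 d\<close>.\<close>

lemma kansa_kernel_IMQ:
  assumes "eps > 0" "d > 0"
  shows "kansa_kernel eps inverse (\<lambda>w. (of_real eps)\<^sup>2 * ((3 - of_nat d) * inverse w ^ 3 - 3 * inverse w ^ 5))"
proof
  show "\<exists>k c. 0 < k \<and> c \<noteq> 0 \<and>
     ((\<lambda>w. w ^ k * ((complex_of_real eps)\<^sup>2 * ((3 - of_nat d) * inverse w ^ 3 - 3 * inverse w ^ 5) * inverse w)) \<longlongrightarrow> c) (at 0)"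
  proof (intro exI conjI)
    have "\<forall>\<^sub>F w in at 0. (complex_of_real eps)\<^sup>2 * ((3 - of_nat d) * w\<^sup>2 - 3)
        = w ^ 6 * ((complex_of_real eps)\<^sup>2 * ((3 - of_nat d) * inverse w ^ 3 - 3 * inverse w ^ 5) * inverse w)"
      by (rule eventually_mono[OF eventually_neq_at_within[of 0]]) (simp add: field_simps eval_nat_numeral)
    moreover have "((\<lambda>w. (complex_of_real eps)\<^sup>2 * ((3 - of_nat d) * w\<^sup>2 - 3)) \<longlongrightarrow> - 3 * (of_real eps)\<^sup>2) (at 0)"
      by (rule tendsto_eq_intros refl | simp)+
    ultimately show "((\<lambda>w. w ^ 6 * ((complex_of_real eps)\<^sup>2 * ((3 - of_nat d) * inverse w ^ 3 - 3 * inverse w ^ 5) * inverse w))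
        \<longlongrightarrow> - 3 * (of_real eps)\<^sup>2) (at 0)" by (rule Lim_transform_eventually[rotated])
  qed (use assms in auto)
  show "((\<lambda>w. (complex_of_real eps)\<^sup>2 * ((3 - of_nat d) * inverse w ^ 3 - 3 * inverse w ^ 5)) \<longlongrightarrow> 0) at_infinity"
    by (rule tendsto_eq_intros tendsto_inverse_0 refl | simp)+
qed (use assms in \<open>auto intro!: holomorphic_intros simp: algebra_simps\<close>)

theorem theorem1:
  fixes \<Omega> :: "'a::euclidean_space set"
    and eps :: real
    and phi :: "real \<Rightarrow> real"
    and m :: nat
    and Q :: "nat \<Rightarrow> 'a"
    and \<sigma> :: "'a \<Rightarrow> real"
  assumes "open \<Omega>" and "connected \<Omega>" and "bounded \<Omega>" and "\<Omega> \<noteq> {}"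
    and "eps > 0"
    and "phi = MQ eps \<or> phi = IMQ eps"
    and "m \<ge> 1"
    and "inj_on Q {..<m}" and "\<forall>k<m. Q k \<in> frontier \<Omega>"
    and "set_integrable lborel \<Omega> \<sigma>"
    and "AE x in lborel. x \<in> \<Omega> \<longrightarrow> \<sigma> x \<ge> 0"
    and "(LINT x:\<Omega>|lborel. \<sigma> x) = 1"
  shows "\<forall>n. AE P in (\<Pi>\<^sub>M i\<in>(UNIV::nat set). density lborel (\<lambda>x. ennreal (indicator \<Omega> x * \<sigma> x))).
           det (kansa_matrix phi Q m P n) \<noteq> 0"
proof
  fix n
  let ?g = "\<lambda>x. indicator \<Omega> x * \<sigma> x"
  let ?M = "density lborel (\<lambda>x. ennreal (?g x))"
  have int: "integrable lborel ?g" using assms(10) by (simp add: set_integrable_def)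
  have [measurable]: "?g \<in> borel_measurable lborel" using int by (rule borel_measurable_integrable)
  have M: "prob_space ?M" "sets ?M = sets borel"
  proof -
    \<comment> \<open>\<open>ennreal\<close> replaces negative values by 0; they occur only on a
      null set, so the total mass is still the integral of the density.\<close>
    have "AE x in lborel. 0 \<le> ?g x" using assms(11) by eventually_elim (auto split: split_indicator)
    then have "(\<integral>\<^sup>+ x. ennreal (?g x) \<partial>lborel) = ennreal (\<integral>x. ?g x \<partial>lborel)"
      by (rule nn_integral_eq_integral[OF int])
    also have "\<dots> = 1" using assms(12) by (simp add: set_lebesgue_integral_def)
    finally show "prob_space ?M" by (intro prob_spaceI) (simp add: emeasure_density)
  qed simp
  have ac: "AE x in ?M. R x" if "AE x in lborel. R x" for R
    using that by (subst AE_density) auto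
  have Q: "inj_on Q {0..<m'}" if "m' \<le> m" for m'
    by (rule inj_on_subset[OF assms(8)]) (use that in auto)
  from assms(6) show "AE P in (\<Pi>\<^sub>M i\<in>(UNIV::nat set). ?M). det (kansa_matrix phi Q m P n) \<noteq> 0"
  proof
    assume phi: "phi = MQ eps"
    interpret kansa_kernel eps "\<lambda>w. w" "\<lambda>w. (of_real eps)\<^sup>2 * ((of_nat DIM('a) - 1) * inverse w + inverse w ^ 3)"
      by (rule kansa_kernel_MQ) (use assms(5) in auto)
    show ?thesis
      by (rule AE_det_kansa_matrix[OF M ac assms(8)])
         (use multiquadric_nonsingular[OF Q assms(5)] in \<open>auto simp: phi laplacian_MQ, auto simp: MQ_def mq_weight_def\<close>)
  next
    assume phi: "phi = IMQ eps"
    interpret kansa_kernel eps inverse "\<lambda>w. (of_real eps)\<^sup>2 * ((3 - of_nat DIM('a)) * inverse w ^ 3 - 3 * inverse w ^ 5)"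
      by (rule kansa_kernel_IMQ) (use assms(5) in auto)
    show ?thesis
      by (rule AE_det_kansa_matrix[OF M ac assms(8)])
         (use inverse_multiquadric_nonsingular[OF Q assms(5)] in \<open>auto simp: phi laplacian_IMQ,
           auto simp: IMQ_def mq_weight_def inverse_eq_divide\<close>)
  qed
qed

end
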